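(* Let $h\in(0,1)$ and $k\ge 2$. Let $\phi$ be strictly convex and $\mathcal{C}^2$ on the convex set $\Omega\subset\mathbb{R}^d$, and assume $F_0=\overline{\mathrm{conv}(\mathrm{supp}(P))}\subset\mathring{\Omega}$. Assume that $P\|u\|^p<+\infty$ for some $p\ge 2$, and that $R^*_{k-1,h}-R^*_{k,h}>0$. Let $0\le b<B_h$, where $B_h$ is the discernability factor. Then there are constants $C_{P,b}$ and $K_{P,b}$, not depending on $n$ nor $s$, such that, for $n$ large enough, with probability larger than $1-n^{-p/2}$, for every number $s$ of adversarial points with $s/(n+s)\le b$ and every choice of adversarial points $x_1,\dots,x_s$, \[ \max_{j\in\{1,\dots,k\}} d_\phi\left(B(0,C_{P,b}),\hat c_{n+s,h,j}\right)\le K_{P,b}. \]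
   Context: For $x,y\in\Omega$, $d_\phi(x,y)=\phi(x)-\phi(y)-\langle\nabla_y\phi,x-y\rangle$ (Bregman divergence). For a set $K$, $d_\phi(K,x)=\min_{y\in K}d_\phi(y,x)$, where the minimum is over the points $y$ of $K$ lying in $\Omega$; $B(0,C)$ is the Euclidean ball. A $j$-point codebook is $\mathbf{c}=(c_1,\dots,c_j)\in\Omega^{(j)}$ (a $j$-tuple of points of $\Omega$), and $d_\phi(x,\mathbf{c})=\min_{i}d_\phi(x,c_i)$. $P$ is a probability distribution on $\mathbb{R}^d$; $Qf(u)$ denotes the integral of $f$ with respect to $Q$; $\|\cdot\|$ is the Euclidean norm. $B_\phi(\mathbf{c},r)=\{x:\sqrt{d_\phi(x,\mathbf{c})}<r\}$, and $\bar B_\phi(\mathbf{c},r)$ is the same set with $\le$. For $h\in(0,1]$, $r_h(\mathbf{c})$ is the smallest $r\ge 0$ (possibly $+\infty$ if $h=1$) such that $P(B_\phi(\mathbf{c},r))\le h\le P(\bar B_\phi(\mathbf{c},r))$. $\mathcal{P}_h$ is the set of probability measures $\frac1h Q$ where $Q$ is a sub-measure of $P$ (i.e. $Q(A)\le P(A)$ for all Borel $A$) with $Q(\mathbb{R}^d)=h$. $\mathcal{P}_h(\mathbf{c})$ is the set of $\tilde P\in\mathcal{P}_h$ that coincide with $P/h$ on $B_\phi(\mathbf{c},r_h(\mathbf{c}))$ and have support included in $\bar B_\phi(\mathbf{c},r_h(\mathbf{c}))$. The $h$-trimmed distortion is $R_h(\mathbf{c})=h\,\tilde P_{\mathbf{c}}d_\phi(u,\mathbf{c})$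 for any $\tilde P_{\mathbf{c}}\in\mathcal{P}_h(\mathbf{c})$ (the value does not depend on the choice), and $R_0=0$. $R^*_{j,h}=\inf_{\mathbf{c}\in\Omega^{(j)}}R_h(\mathbf{c})$ is the $j$-point $h$-trimmed optimal distortion. Discernability factor: for $b\le h$ put $h_b^-=(h-b)/(1-b)$, $h_b^+=h/(1-b)$; then \[B_h=\sup\Big\{b\ge 0 : b\le h\wedge(1-h)\text{ and }\min_{j\in\{2,\dots,k\}}\big(R^*_{j-1,h_b^-}-R^*_{j,h_b^+}\big)>0\Big\}.\] Contaminated sample: $X_1,\dots,X_n$ are i.i.d. with law $P$. Given $s$ adversarial points $x_1,\dots,x_s\in\Omega$, $P_{n+s}$ is the empirical distribution of the $n+s$ points $X_1,\dots,X_n,x_1,\dots,x_s$, $R_{n+s,h}$ is the $h$-trimmed distortion defined with $P_{n+s}$ in place of $P$, and $\hat{\mathbf{c}}_{n+s,h}=(\hat c_{n+s,h,1},\dots,\hat c_{n+s,h,k})$ is a minimizer of $R_{n+s,h}$ over $\Omega^{(k)}$. *)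

theory Defs
  imports "HOL-Probability.Probability"
begin

definition strictly_convex_on :: "'a::real_vector set \<Rightarrow> ('a \<Rightarrow> real) \<Rightarrow> bool" where
  "strictly_convex_on \<Omega> \<phi> \<longleftrightarrow> convex \<Omega> \<and>
     (\<forall>x\<in>\<Omega>. \<forall>y\<in>\<Omega>. \<forall>t. x \<noteq> y \<longrightarrow> 0 < t \<longrightarrow> t < 1 \<longrightarrow>
        \<phi> ((1 - t) *\<^sub>R x + t *\<^sub>R y) < (1 - t) * \<phi> x + t * \<phi> y)"

text \<open>
  \<^term>\<open>\<Omega>\<close> need not be open, so derivatives are taken within \<^term>\<open>\<Omega>\<close>; they are unique as soon as
  \<^term>\<open>\<Omega>\<close> is convex with nonempty interior, and they are the usual ones at interior points.
\<close>

definition gradient_on :: "'a::euclidean_space set \<Rightarrow> ('a \<Rightarrow> real) \<Rightarrow> 'a \<Rightarrow> 'a" where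
  "gradient_on \<Omega> \<phi> y = (SOME g. (\<phi> has_derivative (\<lambda>v. g \<bullet> v)) (at y within \<Omega>))"

definition C2_on :: "'a::euclidean_space set \<Rightarrow> ('a \<Rightarrow> real) \<Rightarrow> bool" where
  "C2_on \<Omega> \<phi> \<longleftrightarrow> \<phi> differentiable_on \<Omega> \<and>
     (\<exists>H :: 'a \<Rightarrow> ('a \<Rightarrow>\<^sub>L 'a).
        (\<forall>x\<in>\<Omega>. (gradient_on \<Omega> \<phi> has_derivative blinfun_apply (H x)) (at x within \<Omega>)) \<and>
        continuous_on \<Omega> H)"

definition bregman :: "'a::euclidean_space set \<Rightarrow> ('a \<Rightarrow> real) \<Rightarrow> 'a \<Rightarrow> 'a \<Rightarrow> real" where
  "bregman \<Omega> \<phi> x y = \<phi> x - \<phi> y - gradient_on \<Omega> \<phi> y \<bullet> (x - y)"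

text \<open>
  The infimum is taken in the extended reals, so that it is \<^term>\<open>\<infinity>\<close> when \<^term>\<open>K\<close> does not meet
  \<^term>\<open>\<Omega>\<close>.
\<close>

definition bregman_set :: "'a::euclidean_space set \<Rightarrow> ('a \<Rightarrow> real) \<Rightarrow> 'a set \<Rightarrow> 'a \<Rightarrow> ereal" where
  "bregman_set \<Omega> \<phi> K x = (INF y\<in>K \<inter> \<Omega>. ereal (bregman \<Omega> \<phi> y x))"

definition codebooks :: "'a set \<Rightarrow> nat \<Rightarrow> 'a list set" where
  "codebooks \<Omega> j = {c. length c = j \<and> set c \<subseteq> \<Omega>}"

definition bregman_code :: "'a::euclidean_space set \<Rightarrow> ('a \<Rightarrow> real) \<Rightarrow> 'a \<Rightarrow> 'a list \<Rightarrow> real" where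
  "bregman_code \<Omega> \<phi> x c = Min (bregman \<Omega> \<phi> x ` set c)"

definition breg_ball :: "'a::euclidean_space set \<Rightarrow> ('a \<Rightarrow> real) \<Rightarrow> 'a list \<Rightarrow> ereal \<Rightarrow> 'a set" where
  "breg_ball \<Omega> \<phi> c r = {x \<in> \<Omega>. ereal (sqrt (bregman_code \<Omega> \<phi> x c)) < r}"

definition breg_cball :: "'a::euclidean_space set \<Rightarrow> ('a \<Rightarrow> real) \<Rightarrow> 'a list \<Rightarrow> ereal \<Rightarrow> 'a set" where
  "breg_cball \<Omega> \<phi> c r = {x \<in> \<Omega>. ereal (sqrt (bregman_code \<Omega> \<phi> x c)) \<le> r}"

text \<open>
  A convex set need not be a Borel set, and then neither need the Bregman balls be.  They are
  measurable for the completion of every Borel probability measure that is carried by a closed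
  subset of \<^term>\<open>\<Omega>\<close> (such as the measure of the population, or an empirical measure of points
  of \<^term>\<open>\<Omega>\<close>).
\<close>

definition trim_radius ::
  "'a::euclidean_space set \<Rightarrow> ('a \<Rightarrow> real) \<Rightarrow> 'a measure \<Rightarrow> real \<Rightarrow> 'a list \<Rightarrow> ereal" where
  "trim_radius \<Omega> \<phi> P h c = (LEAST r. 0 \<le> r \<and>
      measure (completion P) (breg_ball \<Omega> \<phi> c r) \<le> h \<and>
      h \<le> measure (completion P) (breg_cball \<Omega> \<phi> c r))"

definition measure_support :: "'a::topological_space measure \<Rightarrow> 'a set" where
  "measure_support P = {x. \<forall>U. open U \<longrightarrow> x \<in> U \<longrightarrow> 0 < emeasure P U}"

definition trimmed_measures :: "'a::euclidean_space measure \<Rightarrow> real \<Rightarrow> 'a measure set" where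
  "trimmed_measures P h = {scale_measure (ennreal (1 / h)) Q | Q.
      sets Q = sets borel \<and> (\<forall>A\<in>sets borel. emeasure Q A \<le> emeasure P A) \<and>
      emeasure Q UNIV = ennreal h}"

text \<open>
  Again because the ball need not be a Borel set, coincidence of two measures on it means that they
  agree on all its Borel subsets.
\<close>

definition trimmed_measures_code ::
  "'a::euclidean_space set \<Rightarrow> ('a \<Rightarrow> real) \<Rightarrow> 'a measure \<Rightarrow> real \<Rightarrow> 'a list \<Rightarrow> 'a measure set" where
  "trimmed_measures_code \<Omega> \<phi> P h c = {P' \<in> trimmed_measures P h.
      (\<forall>A\<in>sets borel. A \<subseteq> breg_ball \<Omega> \<phi> c (trim_radius \<Omega> \<phi> P h c) \<longrightarrow>
          emeasure P' A = emeasure P A / ennreal h) \<and>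
      measure_support P' \<subseteq> breg_cball \<Omega> \<phi> c (trim_radius \<Omega> \<phi> P h c)}"

text \<open>
  No completion is needed here, since \<^const>\<open>nn_integral\<close> is unchanged by it
  (fact \<open>nn_integral_completion\<close>).
\<close>

definition trimmed_distortion ::
  "'a::euclidean_space set \<Rightarrow> ('a \<Rightarrow> real) \<Rightarrow> 'a measure \<Rightarrow> real \<Rightarrow> 'a list \<Rightarrow> ennreal" where
  "trimmed_distortion \<Omega> \<phi> P h c =
     (if h = 0 then 0
      else ennreal h *
        (\<integral>\<^sup>+ u. ennreal (bregman_code \<Omega> \<phi> u c)
           \<partial>(SOME P'. P' \<in> trimmed_measures_code \<Omega> \<phi> P h c)))"

definition opt_distortion ::
  "'a::euclidean_space set \<Rightarrow> ('a \<Rightarrow> real) \<Rightarrow> 'a measure \<Rightarrow> nat \<Rightarrow> real \<Rightarrow> ereal" where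
  "opt_distortion \<Omega> \<phi> P j h =
     enn2ereal (INF c\<in>codebooks \<Omega> j. trimmed_distortion \<Omega> \<phi> P h c)"

definition discernability_factor ::
  "'a::euclidean_space set \<Rightarrow> ('a \<Rightarrow> real) \<Rightarrow> 'a measure \<Rightarrow> nat \<Rightarrow> real \<Rightarrow> ereal" where
  "discernability_factor \<Omega> \<phi> P k h = Sup (ereal ` {b. 0 \<le> b \<and> b \<le> min h (1 - h) \<and>
      0 < Min ((\<lambda>j. opt_distortion \<Omega> \<phi> P (j - 1) ((h - b) / (1 - b))
                    - opt_distortion \<Omega> \<phi> P j (h / (1 - b))) ` {2..k})})"

definition empirical_measure :: "'a::euclidean_space list \<Rightarrow> 'a measure" where
  "empirical_measure zs = distr (uniform_count_measure {..<length zs}) borel (\<lambda>i. zs ! i)"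

end

theory Submission
  imports Defs "HOL-Real_Asymp.Real_Asymp"
begin

text \<open>
  The trimmed distortion has a dual form: for every codebook \<open>c\<close>,
  \<open>R\<^sub>h(c) = max\<^sub>t (h t - P (t - d(u, c))\<^sub>+)\<close>, attained at the squared trimming radius.  It is linear in the
  measure and involves bounded functions only.  Suppose that a centre of an optimal codebook \<open>c\<close> of
  the contaminated sample is at divergence more than \<open>T\<close> from the whole ball of radius \<open>C\<close>.  Removing it
  does not change \<open>(t - d(u, c))\<^sub>+\<close> on that ball for \<open>t \<le> T\<close>, so up to small errors \<open>R\<^sub>h(c)\<close> is at least the
  fraction of clean points times the optimal \<open>k - 1\<close> point distortion of \<open>P\<close> at level \<open>(h - b)/(1 - b)\<close>.
  A fixed nearly optimal \<open>k\<close> point codebook for level \<open>h/(1 - b)\<close> has a strictly smaller distortion,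
  which is a contradiction.  Since \<open>b\<close> is strictly below the discernability factor, the levels can
  be perturbed, which absorbs all truncations.  Uniformity over codebooks needs no
  Vapnik-Chervonenkis theory: \<open>d(u, c)\<close> is \<open>\<phi>\<close> minus an affine minorant of \<open>\<phi>\<close>, and on a compact
  subset of the interior of \<open>\<Omega>\<close> the minorants that come within \<open>T\<close> of \<open>\<phi>\<close> have bounded coefficients.
  Hence the costs truncated at \<open>T\<close> are totally bounded in the supremum norm there, and
  Hoeffding's inequality for finitely many bounded functions suffices.
\<close>

section \<open>Bregman divergences and affine minorants\<close>

text \<open>A linear functional \<open>D\<close> is the inner product with
  \<open>adjoint D 1\<close>, so the choice in \<open>gradient_on\<close> picks a vector that does
  represent the derivative.\<close>

lemma gradient_on_has_derivative:
  fixes \<phi> :: "'a::euclidean_space \<Rightarrow> real"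
  assumes "\<phi> differentiable (at y within \<Omega>)"
  shows "(\<phi> has_derivative (\<lambda>v. gradient_on \<Omega> \<phi> y \<bullet> v)) (at y within \<Omega>)"
proof -
  obtain D where D: "(\<phi> has_derivative D) (at y within \<Omega>)"
    using assms by (auto simp: differentiable_def)
  then have "linear D" by (rule has_derivative_linear)
  then have "D = (\<lambda>v. adjoint D 1 \<bullet> v)"
    using adjoint_works[of D _ 1] by (auto simp: inner_commute)
  with D have "\<exists>g. (\<phi> has_derivative (\<lambda>v. g \<bullet> v)) (at y within \<Omega>)" by metis
  then show ?thesis unfolding gradient_on_def by (rule someI_ex)
qed

text \<open>Along the segment from \<open>y\<close> to \<open>x\<close>, convexity bounds the
  difference quotients at \<open>y\<close> by \<open>\<phi> x - \<phi> y\<close>, and they tend to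
  the directional derivative. Since \<open>y\<close> may lie on the boundary, the derivative is
  one-sided.\<close>

lemma bregman_nonneg:
  assumes conv: "strictly_convex_on \<Omega> \<phi>" and diff: "\<phi> differentiable_on \<Omega>"
    and x: "x \<in> \<Omega>" and y: "y \<in> \<Omega>"
  shows "0 \<le> bregman \<Omega> \<phi> x y"
proof (cases "x = y")
  case True
  then show ?thesis by (simp add: bregman_def)
next
  case False
  define v where "v = x - y"
  define \<psi> where "\<psi> = (\<lambda>s. \<phi> (y + s *\<^sub>R v))"
  let ?g = "gradient_on \<Omega> \<phi> y"
  have line: "(1 - s) *\<^sub>R y + s *\<^sub>R x = y + s *\<^sub>R v" for s
    by (simp add: v_def algebra_simps)
  have "convex \<Omega>" using conv by (simp add: strictly_convex_on_def)
  then have sub: "(\<lambda>s. y + s *\<^sub>R v) ` {0..1} \<subseteq> \<Omega>"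
    using x y by (auto simp flip: line intro!: convexD)
  have D: "(\<phi> has_derivative (\<lambda>v. ?g \<bullet> v)) (at (y + 0 *\<^sub>R v) within (\<lambda>s. y + s *\<^sub>R v) ` {0..1})"
    using gradient_on_has_derivative[of \<phi> y \<Omega>] diff y sub
    by (auto simp: differentiable_on_def intro: has_derivative_subset)
  have "((\<lambda>s. \<phi> (y + s *\<^sub>R v)) has_derivative (\<lambda>s. ?g \<bullet> (s *\<^sub>R v))) (at 0 within {0..1})"
    by (rule has_derivative_in_compose[OF _ D]) (auto intro!: derivative_eq_intros)
  then have "(\<psi> has_field_derivative (?g \<bullet> v)) (at 0 within {0..1})"
    by (simp add: has_field_derivative_def \<psi>_def mult_commute_abs)
  then have lim: "((\<lambda>s. (\<psi> s - \<psi> 0) / s) \<longlongrightarrow> ?g \<bullet> v) (at_right 0)"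
    by (simp add: has_field_derivative_iff at_within_Icc_at_right)
  have "\<forall>\<^sub>F s in at_right (0::real). s \<in> {0<..<1}"
    by (rule eventually_at_right_real) simp
  then have "\<forall>\<^sub>F s in at_right 0. (\<psi> s - \<psi> 0) / s \<le> \<phi> x - \<phi> y"
  proof eventually_elim
    case (elim s)
    then have "\<psi> s < (1 - s) * \<phi> y + s * \<phi> x"
      using conv x y False unfolding strictly_convex_on_def \<psi>_def by (auto simp flip: line)
    then have "\<psi> s - \<psi> 0 \<le> s * (\<phi> x - \<phi> y)" by (simp add: \<psi>_def algebra_simps)
    then show ?case using elim by (simp add: divide_le_eq mult.commute)
  qed
  then have "?g \<bullet> v \<le> \<phi> x - \<phi> y"
    by (intro tendsto_upperbound[OF lim]) simp_all
  then show ?thesis by (simp add: bregman_def v_def)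
qed

lemma continuous_on_bregman:
  assumes "continuous_on \<Omega> \<phi>"
  shows "continuous_on \<Omega> (\<lambda>x. bregman \<Omega> \<phi> x y)"
  unfolding bregman_def using assms by (intro continuous_intros) auto

lemma continuous_on_Min_image:
  fixes f :: "'a::topological_space \<Rightarrow> 'b \<Rightarrow> real"
  assumes "finite S" "S \<noteq> {}" "\<And>i. i \<in> S \<Longrightarrow> continuous_on A (\<lambda>x. f x i)"
  shows "continuous_on A (\<lambda>x. Min (f x ` S))"
  using assms
proof (induction S rule: finite_ne_induct)
  case (singleton i)
  then show ?case by simp
next
  case (insert i S)
  have "Min (f x ` insert i S) = min (f x i) (Min (f x ` S))" for x
    using insert by simp
  then show ?case
    using insert by (simp add: continuous_on_min)
qed

lemma continuous_on_bregman_code: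
  assumes "continuous_on \<Omega> \<phi>" "c \<noteq> []"
  shows "continuous_on \<Omega> (\<lambda>x. bregman_code \<Omega> \<phi> x c)"
  unfolding bregman_code_def
  by (rule continuous_on_Min_image) (use assms in \<open>auto intro: continuous_on_bregman\<close>)

lemma bregman_code_nonneg:
  assumes "strictly_convex_on \<Omega> \<phi>" "\<phi> differentiable_on \<Omega>" "c \<noteq> []" "set c \<subseteq> \<Omega>" "x \<in> \<Omega>"
  shows "0 \<le> bregman_code \<Omega> \<phi> x c"
  unfolding bregman_code_def using assms by (auto intro!: bregman_nonneg)

text \<open>In \<open>x\<close> the divergence is \<open>\<phi> x\<close> minus an affine function
  with coefficients \<open>(a y, g y)\<close>. If it drops below \<open>T\<close> somewhere on
  \<open>K\<close>, nonnegativity near \<open>K\<close> bounds these coefficients, so finitely many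
  suffice up to \<open>e\<close>; otherwise the truncated divergence is constantly \<open>T\<close>
  on \<open>K\<close>.\<close>

lemma bregman_truncated_net:
  fixes \<Omega> :: "'a::euclidean_space set"
  assumes cont: "continuous_on \<Omega> \<phi>"
    and nonneg: "\<And>x y. x \<in> \<Omega> \<Longrightarrow> y \<in> \<Omega> \<Longrightarrow> 0 \<le> bregman \<Omega> \<phi> x y"
    and K: "compact K" "K \<subseteq> interior \<Omega>" and e: "0 < e"
  obtains N where "finite N" "N \<subseteq> \<Omega>"
    "\<And>y. y \<in> \<Omega> \<Longrightarrow>
      \<exists>y'\<in>N. \<forall>x\<in>K. \<bar>min (bregman \<Omega> \<phi> x y) T - min (bregman \<Omega> \<phi> x y') T\<bar> \<le> e"
proof -
  \<comment> \<open>The margin \<delta> allows nonnegativity to be tested at points beyond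
    \<open>K\<close>, which controls the slope.\<close>
  obtain \<delta> where \<delta>: "0 < \<delta>" "(\<Union>x\<in>K. cball x \<delta>) \<subseteq> interior \<Omega>"
    using compact_subset_open_imp_cball_epsilon_subset[OF K(1) open_interior K(2)] by blast
  define L where "L = (\<Union>x\<in>K. cball x \<delta>)"
  have L: "compact L" "L \<subseteq> \<Omega>"
    using compact_minkowski_sum_cball[OF K(1)] \<delta>(2) interior_subset unfolding L_def by blast+
  have "bounded (\<phi> ` L)"
    using L cont by (intro compact_imp_bounded compact_continuous_image)
      (auto intro: continuous_on_subset)
  then obtain B where B: "\<And>x. x \<in> L \<Longrightarrow> \<bar>\<phi> x\<bar> \<le> B" by (auto simp: bounded_iff)
  obtain R where R: "\<And>x. x \<in> K \<Longrightarrow> norm x \<le> R" "0 < R"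
    using K(1) compact_imp_bounded bounded_pos by metis
  define g where "g = gradient_on \<Omega> \<phi>"
  define a where "a y = \<phi> y - g y \<bullet> y" for y
  have breg: "bregman \<Omega> \<phi> x y = \<phi> x - (a y + g y \<bullet> x)" for x y
    by (simp add: bregman_def g_def a_def inner_diff_right)
  define G where "G = {y \<in> \<Omega>. \<exists>x\<in>K. bregman \<Omega> \<phi> x y < T}"
  have bd: "norm (g y) \<le> (2 * B + T) / \<delta>" "\<bar>a y\<bar> \<le> B + \<bar>T\<bar> + (2 * B + T) / \<delta> * R" if y: "y \<in> G" for y
  proof -
    obtain x where x: "x \<in> K" "\<phi> x - (a y + g y \<bullet> x) < T" and yO: "y \<in> \<Omega>"
      using y by (auto simp: G_def breg)
    have xL: "x \<in> L" using x(1) \<delta>(1) by (force simp: L_def)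
    \<comment> \<open>Moving by \<delta> in the direction of \<open>g y\<close> raises the affine
      minorant by \<open>\<delta> * norm (g y)\<close>, yet it stays below \<open>\<phi>\<close>,
      which is bounded on \<open>L\<close>.\<close>
    define u where "u = sgn (g y)"
    have "x + \<delta> *\<^sub>R u \<in> cball x \<delta>" using \<delta>(1) by (simp add: dist_norm u_def norm_sgn)
    then have z: "x + \<delta> *\<^sub>R u \<in> L" using x(1) by (auto simp: L_def)
    have "0 \<le> \<phi> (x + \<delta> *\<^sub>R u) - (a y + g y \<bullet> (x + \<delta> *\<^sub>R u))"
      using nonneg[of "x + \<delta> *\<^sub>R u" y] z L(2) yO by (auto simp: breg)
    moreover have "g y \<bullet> u = norm (g y)"
      by (cases "g y = 0")
        (auto simp: u_def sgn_div_norm inner_commute divide_simps power2_norm_eq_inner[symmetric] power2_eq_square)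
    ultimately have "\<delta> * norm (g y) \<le> 2 * B + T"
      using x(2) B[OF z] B[OF xL] by (simp add: inner_add_right)
    then show 1: "norm (g y) \<le> (2 * B + T) / \<delta>" using \<delta>(1) by (simp add: field_simps)
    have "\<bar>g y \<bullet> x\<bar> \<le> norm (g y) * norm x" by (rule Cauchy_Schwarz_ineq2)
    also have "\<dots> \<le> (2 * B + T) / \<delta> * R"
      using 1 R x(1) by (intro mult_mono order_trans[OF norm_ge_zero 1]) auto
    finally have 2: "\<bar>g y \<bullet> x\<bar> \<le> (2 * B + T) / \<delta> * R" .
    have "0 \<le> \<phi> x - (a y + g y \<bullet> x)"
      using nonneg[of x y] xL L(2) yO by (auto simp: breg)
    with 2 x(2) B[OF xL] show "\<bar>a y\<bar> \<le> B + \<bar>T\<bar> + (2 * B + T) / \<delta> * R" by linarith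
  qed
  define A where "A = (\<lambda>y. (a y, g y)) ` G"
  have "bounded A"
  proof -
    have "norm z \<le> (B + \<bar>T\<bar> + (2 * B + T) / \<delta> * R) + (2 * B + T) / \<delta>" if z: "z \<in> A" for z
    proof -
      obtain y where y: "y \<in> G" "z = (a y, g y)" using z by (auto simp: A_def)
      have "norm z \<le> norm (a y) + norm (g y)" using norm_Pair_le[of "a y" "g y"] y(2) by simp
      with bd[OF y(1)] show ?thesis by simp
    qed
    then show ?thesis by (rule boundedI)
  qed
  then have compA: "compact (closure A)" by simp
  \<comment> \<open>Perturbing both coefficients by \<open>r\<close> changes the affine function by
    at most \<open>r + r * R = e\<close> on \<open>K\<close>.\<close>
  define r where "r = e / (1 + R)"
  have r: "0 < r" using e R by (simp add: r_def)
  have "closure A \<subseteq> (\<Union>y\<in>G. ball (a y, g y) r)"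
  proof
    fix z assume "z \<in> closure A"
    then obtain w where "w \<in> A" "dist w z < r" using r closure_approachable by metis
    then show "z \<in> (\<Union>y\<in>G. ball (a y, g y) r)" by (auto simp: A_def)
  qed
  then obtain C where C: "C \<subseteq> G" "finite C" "closure A \<subseteq> (\<Union>y\<in>C. ball (a y, g y) r)"
    using compactE_image[OF compA, of G "\<lambda>y. ball (a y, g y) r"] by auto
  \<comment> \<open>All points of \<open>\<Omega>\<close> outside \<open>G\<close> have the same
    truncated divergence on \<open>K\<close>, so one representative is enough, if there is
    any.\<close>
  obtain D where D: "finite D" "D \<subseteq> \<Omega> - G" "\<Omega> - G \<noteq> {} \<Longrightarrow> D \<noteq> {}"
  proof (cases "\<Omega> - G = {}")
    case True
    show thesis by (rule that[of "{}"]) (use True in auto)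
  next
    case False
    then obtain y where "y \<in> \<Omega> - G" by blast
    then show thesis by (intro that[of "{y}"]) auto
  qed
  show thesis
  proof (rule that[of "C \<union> D"])
    show "finite (C \<union> D)" "C \<union> D \<subseteq> \<Omega>" using C D by (auto simp: G_def)
    fix y assume y: "y \<in> \<Omega>"
    show "\<exists>y'\<in>C \<union> D. \<forall>x\<in>K. \<bar>min (bregman \<Omega> \<phi> x y) T - min (bregman \<Omega> \<phi> x y') T\<bar> \<le> e"
    proof (cases "y \<in> G")
      case True
      then have "(a y, g y) \<in> closure A" using closure_subset[of A] by (auto simp: A_def)
      then obtain y' where y': "y' \<in> C" "dist (a y', g y') (a y, g y) < r" using C(3) by auto
      have "\<bar>min (bregman \<Omega> \<phi> x y) T - min (bregman \<Omega> \<phi> x y') T\<bar> \<le> e" if x: "x \<in> K" for x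
      proof -
        have d: "\<bar>a y' - a y\<bar> \<le> r" "norm (g y' - g y) \<le> r"
          using y'(2) dist_fst_le[of "(a y', g y')" "(a y, g y)"] dist_snd_le[of "(a y', g y')" "(a y, g y)"]
          by (auto simp: dist_norm)
        have "\<bar>(g y' - g y) \<bullet> x\<bar> \<le> norm (g y' - g y) * norm x" by (rule Cauchy_Schwarz_ineq2)
        also have "\<dots> \<le> r * R" using d R x r by (intro mult_mono) auto
        finally have "\<bar>bregman \<Omega> \<phi> x y - bregman \<Omega> \<phi> x y'\<bar> \<le> r + r * R"
          using d(1) by (simp add: breg inner_diff_left)
        also have "\<dots> = r * (1 + R)" by (simp add: algebra_simps)
        also have "\<dots> = e" using R by (simp add: r_def)
        finally show ?thesis by linarith
      qed
      then show ?thesis using y'(1) by blast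
    next
      case False
      then obtain y' where y': "y' \<in> D" "y' \<in> \<Omega>" "y' \<notin> G" using D y by blast
      have "T \<le> bregman \<Omega> \<phi> x y" "T \<le> bregman \<Omega> \<phi> x y'" if "x \<in> K" for x
        using False y y' that by (auto simp: G_def not_less)
      then show ?thesis using y'(1) e by (intro bexI[of _ y']) auto
    qed
  qed
qed

text \<open>Minima over centres do not increase uniform errors of truncated values, which passes
  nets for single centres on to codebooks.\<close>

lemma abs_min_Min_diff_le:
  fixes f g :: "'b \<Rightarrow> real"
  assumes "finite S" "S \<noteq> {}" "\<And>i. i \<in> S \<Longrightarrow> \<bar>min (f i) T - min (g i) T\<bar> \<le> e"
  shows "\<bar>min (Min (f ` S)) T - min (Min (g ` S)) T\<bar> \<le> e"
proof -
  have *: "min (Min (f ` S)) T \<le> min (Min (g ` S)) T + e"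
    if h: "\<And>i. i \<in> S \<Longrightarrow> \<bar>min (f i) T - min (g i) T\<bar> \<le> e" for f g :: "'b \<Rightarrow> real"
  proof -
    have "Min (g ` S) \<in> g ` S" using assms by simp
    then obtain i where i: "i \<in> S" "Min (g ` S) = g i" by auto
    have "Min (f ` S) \<le> f i" using i assms by simp
    with h[OF i(1)] i(2) show ?thesis by linarith
  qed
  from *[of f g] *[of g f] assms(3) show ?thesis by (force simp: abs_minus_commute)
qed

text \<open>Each centre is replaced by a close net point, and there are finitely many lists of
  length \<open>j\<close> over a finite set.\<close>

lemma bregman_code_truncated_net:
  fixes \<Omega> :: "'a::euclidean_space set"
  assumes "continuous_on \<Omega> \<phi>"
    and "\<And>x y. x \<in> \<Omega> \<Longrightarrow> y \<in> \<Omega> \<Longrightarrow> 0 \<le> bregman \<Omega> \<phi> x y"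
    and "compact K" "K \<subseteq> interior \<Omega>" "0 < e" "0 < j"
  obtains N where "finite N" "N \<subseteq> codebooks \<Omega> j"
    "\<And>c. c \<in> codebooks \<Omega> j \<Longrightarrow>
      \<exists>c'\<in>N. \<forall>x\<in>K. \<bar>min (bregman_code \<Omega> \<phi> x c) T - min (bregman_code \<Omega> \<phi> x c') T\<bar> \<le> e"
proof -
  obtain N where N: "finite N" "N \<subseteq> \<Omega>"
    "\<And>y. y \<in> \<Omega> \<Longrightarrow>
      \<exists>y'\<in>N. \<forall>x\<in>K. \<bar>min (bregman \<Omega> \<phi> x y) T - min (bregman \<Omega> \<phi> x y') T\<bar> \<le> e"
    using bregman_truncated_net[OF assms(1-5), of T] by blast
  then obtain \<pi> where \<pi>: "\<And>y. y \<in> \<Omega> \<Longrightarrow> \<pi> y \<in> N"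
    "\<And>y x. y \<in> \<Omega> \<Longrightarrow> x \<in> K \<Longrightarrow> \<bar>min (bregman \<Omega> \<phi> x y) T - min (bregman \<Omega> \<phi> x (\<pi> y)) T\<bar> \<le> e"
    by metis
  show thesis
  proof (rule that[of "{c. set c \<subseteq> N \<and> length c = j}"])
    show "finite {c. set c \<subseteq> N \<and> length c = j}" using N(1) by (rule finite_lists_length_eq)
    show "{c. set c \<subseteq> N \<and> length c = j} \<subseteq> codebooks \<Omega> j" using N(2) by (auto simp: codebooks_def)
    fix c assume c: "c \<in> codebooks \<Omega> j"
    have "\<bar>min (bregman_code \<Omega> \<phi> x c) T - min (bregman_code \<Omega> \<phi> x (map \<pi> c)) T\<bar> \<le> e" if "x \<in> K" for x
      unfolding bregman_code_def set_map image_image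
      using c \<open>0 < j\<close> \<pi> that by (intro abs_min_Min_diff_le) (auto simp: codebooks_def)
    moreover have "map \<pi> c \<in> {c. set c \<subseteq> N \<and> length c = j}"
      using c \<pi> by (auto simp: codebooks_def)
    ultimately show "\<exists>c'\<in>{c. set c \<subseteq> N \<and> length c = j}.
        \<forall>x\<in>K. \<bar>min (bregman_code \<Omega> \<phi> x c) T - min (bregman_code \<Omega> \<phi> x c') T\<bar> \<le> e" by blast
  qed
qed

section \<open>Duality for the trimmed distortion\<close>

text \<open>The complement of the support is a union of open null sets, and by Lindelof countably
  many of them cover it.\<close>

lemma AE_measure_support:
  fixes M :: "'a::second_countable_topology measure"
  assumes "sets M = sets borel"
  shows "AE x in M. x \<in> measure_support M"
proof -
  define \<U> where "\<U> = {U :: 'a set. open U \<and> emeasure M U = 0}"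
  obtain \<V> where \<V>: "\<V> \<subseteq> \<U>" "countable \<V>" "\<Union>\<V> = \<Union>\<U>"
    using Lindelof[of \<U>] by (auto simp: \<U>_def)
  have "(\<Union>U\<in>\<V>. U) \<in> null_sets M"
    using \<V>(1,2) assms by (intro null_sets_UN') (auto simp: \<U>_def null_sets_def)
  moreover have "{x \<in> space M. x \<notin> measure_support M} \<subseteq> (\<Union>U\<in>\<V>. U)"
    using \<V>(3) by (auto simp: measure_support_def \<U>_def)
  ultimately show ?thesis by (rule AE_I')
qed

text \<open>\<open>A\<close> need not be in \<open>sets M\<close>: it differs from \<open>B\<close>
  inside a null set, hence is measurable for the completion. This replaces Bregman balls by Borel
  sets.\<close>

lemma measure_completion_eq_AE:
  assumes "B \<in> sets M" "AE x in M. x \<in> A \<longleftrightarrow> x \<in> B" "A \<subseteq> space M"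
  shows "measure (completion M) A = measure M B"
proof -
  have AE: "AE x in completion M. x \<in> A \<longleftrightarrow> x \<in> B"
    using assms(2) by (rule AE_completion)
  obtain N where N: "{x \<in> space M. \<not> (x \<in> A \<longleftrightarrow> x \<in> B)} \<subseteq> N" "N \<in> null_sets M"
    using assms(2) by (auto simp: eventually_ae_filter)
  then have "N \<in> null_sets (completion M)" by (simp add: null_sets_completionI)
  then have "A - B \<in> null_sets (completion M)" "B - A \<in> null_sets (completion M)"
    using N(1) assms(3) sets.sets_into_space[OF assms(1)]
    by (auto intro!: null_sets_completion_subset[of _ N])
  moreover have "A = (B - (B - A)) \<union> (A - B)" by blast
  ultimately have "A \<in> sets (completion M)"
    using sets_completionI_sets[OF assms(1)] by (metis null_setsD2 sets.Diff sets.Un)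
  then have "measure (completion M) A = measure (completion M) B"
    using AE assms(1) by (intro measure_eq_AE) (auto intro: sets_completionI_sets)
  then show ?thesis using assms(1) by simp
qed

text \<open>The mass \<open>h - prob B\<close> still missing is spread over \<open>D - B\<close>
  with constant density \<theta>.\<close>

lemma (in prob_space) trimming_weight:
  assumes [measurable]: "B \<in> events" "D \<in> events" and "B \<subseteq> D" and h: "prob B \<le> h" "h \<le> prob D"
  obtains w :: "'a \<Rightarrow> real" where "w \<in> borel_measurable M" "\<And>x. 0 \<le> w x" "\<And>x. w x \<le> 1"
    "\<And>x. x \<in> B \<Longrightarrow> w x = 1" "\<And>x. x \<notin> D \<Longrightarrow> w x = 0" "expectation w = h"
proof -
  \<comment> \<open>If \<open>D - B\<close> is null, then \<open>h = prob B\<close> and no mass is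
    missing, so the value 0 is right.\<close>
  define \<theta> where "\<theta> = (if prob (D - B) = 0 then 0 else (h - prob B) / prob (D - B))"
  define w where "w x = indicator B x + \<theta> * indicator (D - B) x" for x :: 'a
  have diff: "prob (D - B) = prob D - prob B"
    using assms by (intro finite_measure_Diff) auto
  have \<theta>: "0 \<le> \<theta>" "\<theta> \<le> 1"
    using h measure_nonneg[of M "D - B"] by (auto simp: \<theta>_def diff divide_simps)
  have "\<theta> * prob (D - B) = h - prob B" using h by (auto simp: \<theta>_def diff)
  moreover have "expectation w = prob B + \<theta> * prob (D - B)"
    unfolding w_def by (subst Bochner_Integration.integral_add) (auto simp: emeasure_eq_measure)
  ultimately have "expectation w = h" by simp
  moreover have "w \<in> borel_measurable M" unfolding w_def by measurable
  ultimately show thesis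
    using \<theta> \<open>B \<subseteq> D\<close> by (intro that[of w]) (auto simp: w_def indicator_def)
qed

text \<open>
  \<open>F\<close> is a closed carrier of \<open>P\<close> inside \<open>\<Omega>\<close>; on it everything is Borel measurable, which need not be
  the case on \<open>\<Omega>\<close>.
\<close>

definition cost_on ::
  "'a::euclidean_space set \<Rightarrow> 'a set \<Rightarrow> ('a \<Rightarrow> real) \<Rightarrow> 'a list \<Rightarrow> 'a \<Rightarrow> real" where
  "cost_on F \<Omega> \<phi> c x = (if x \<in> F then bregman_code \<Omega> \<phi> x c else 0)"

text \<open>The term subtracted from \<open>h * t\<close> in the dual formula. For nonnegative costs
  and \<open>0 \<le> t\<close> the integrand lies between 0 and \<open>t\<close>, which suits
  concentration.\<close>

definition excess ::
  "'a::euclidean_space set \<Rightarrow> 'a set \<Rightarrow> ('a \<Rightarrow> real) \<Rightarrow> 'a measure \<Rightarrow> 'a list \<Rightarrow> real \<Rightarrow> real" where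
  "excess F \<Omega> \<phi> P c t = (\<integral>x. max 0 (t - cost_on F \<Omega> \<phi> c x) \<partial>P)"

text \<open>One setting for both measures in play: the population, carried by the closed convex hull
  of its support, and the contaminated sample, carried by its finite set of points.\<close>

locale carried_code = prob_space P
  for P :: "'a::euclidean_space measure" +
  fixes F \<Omega> :: "'a set" and \<phi> :: "'a \<Rightarrow> real" and c :: "'a list"
  assumes sets_P: "sets P = sets borel"
    and closed_F: "closed F" and F_sub: "F \<subseteq> \<Omega>" and AE_F: "AE x in P. x \<in> F"
    and cont: "continuous_on F (\<lambda>x. bregman_code \<Omega> \<phi> x c)"
    and nonneg: "\<And>x. x \<in> F \<Longrightarrow> 0 \<le> bregman_code \<Omega> \<phi> x c"
begin

abbreviation "cost \<equiv> cost_on F \<Omega> \<phi> c"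

lemma space_P: "space P = UNIV"
  using sets_eq_imp_space_eq[OF sets_P] by simp

lemma cost_nonneg [simp]: "0 \<le> cost x"
  using nonneg by (simp add: cost_on_def)

lemma borel_F: "F \<in> sets borel"
  using closed_F by simp

lemma measurable_cost: "cost \<in> borel_measurable borel"
  unfolding cost_on_def using borel_F cont
  by (intro borel_measurable_continuous_on_if) auto

lemma measurable_cost_P [measurable]: "cost \<in> borel_measurable P"
  using measurable_cost by (simp add: measurable_cong_sets[OF sets_P refl])

lemma F_in_P [measurable]: "F \<in> sets P"
  using borel_F sets_P by simp

definition sublevel :: "ereal \<Rightarrow> 'a set" where
  "sublevel r = {x \<in> F. ereal (sqrt (cost x)) < r}"

definition csublevel :: "ereal \<Rightarrow> 'a set" where
  "csublevel r = {x \<in> F. ereal (sqrt (cost x)) \<le> r}"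

lemma sublevel_eq: "sublevel r = breg_ball \<Omega> \<phi> c r \<inter> F"
  and csublevel_eq: "csublevel r = breg_cball \<Omega> \<phi> c r \<inter> F"
  using F_sub by (auto simp: sublevel_def csublevel_def breg_ball_def breg_cball_def cost_on_def)

lemma sets_sublevel [measurable]: "sublevel r \<in> sets P" "csublevel r \<in> sets P"
proof -
  have "F \<inter> {x \<in> space P. ereal (sqrt (cost x)) < r} \<in> sets P"
    "F \<inter> {x \<in> space P. ereal (sqrt (cost x)) \<le> r} \<in> sets P" by measurable
  moreover have "sublevel r = F \<inter> {x \<in> space P. ereal (sqrt (cost x)) < r}"
    "csublevel r = F \<inter> {x \<in> space P. ereal (sqrt (cost x)) \<le> r}"
    by (auto simp: sublevel_def csublevel_def space_P)
  ultimately show "sublevel r \<in> sets P" "csublevel r \<in> sets P" by simp_all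
qed

text \<open>Closedness matters because a measure that vanishes off a closed set has its support
  inside it.\<close>

lemma closed_csublevel: "closed (csublevel r)"
proof (cases r)
  case (real \<rho>)
  have "closed {x \<in> F. bregman_code \<Omega> \<phi> x c \<in> {s. sqrt s \<le> \<rho>}}"
    by (rule continuous_closed_preimage[OF cont closed_F, unfolded vimage_def Int_def mem_Collect_eq])
      (intro closed_Collect_le continuous_intros)
  moreover have "csublevel r = {x \<in> F. bregman_code \<Omega> \<phi> x c \<in> {s. sqrt s \<le> \<rho>}}"
    by (auto simp: csublevel_def cost_on_def real)
  ultimately show ?thesis by simp
qed (use closed_F in \<open>auto simp: csublevel_def\<close>)

lemma completion_balls:
  "measure (completion P) (breg_ball \<Omega> \<phi> c r) = prob (sublevel r)"
  "measure (completion P) (breg_cball \<Omega> \<phi> c r) = prob (csublevel r)"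
  using AE_F sets_sublevel[of r] unfolding sublevel_eq csublevel_eq
  by (auto intro!: measure_completion_eq_AE simp: space_P)

lemma prob_F: "prob F = 1"
  using AE_F by (simp add: prob_eq_1)

text \<open>The least radius is the infimum of those whose closed ball has mass at least
  \<open>h\<close>. Continuity from above keeps this bound at the infimum; continuity from below
  along smaller radii bounds the mass of the open ball.\<close>

lemma trim_radius_quantile:
  assumes h: "0 < h" "h \<le> 1"
  defines "r \<equiv> trim_radius \<Omega> \<phi> P h c"
  shows "0 \<le> r" "prob (sublevel r) \<le> h" "h \<le> prob (csublevel r)"
proof -
  define S where "S = {r. 0 \<le> r \<and> h \<le> prob (csublevel r)}"
  define r0 where "r0 = Inf S"
  have "csublevel \<infinity> = F" by (auto simp: csublevel_def)
  then have "\<infinity> \<in> S" using h by (simp add: S_def prob_F)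
  then obtain u where u: "decseq u" "range u \<subseteq> S" "r0 = (INF i. u i)"
    using Inf_countable_INF[of S] by (auto simp: r0_def)
  have r0: "0 \<le> r0" unfolding r0_def by (rule Inf_greatest) (simp add: S_def)
  have "csublevel r0 = (\<Inter>i. csublevel (u i))"
    by (auto simp: csublevel_def u(3) le_INF_iff)
  moreover have "(\<lambda>i. prob (csublevel (u i))) \<longlonglongrightarrow> prob (\<Inter>i. csublevel (u i))"
    using u(1) by (intro finite_Lim_measure_decseq)
      (auto simp: decseq_def csublevel_def intro: order_trans)
  moreover have "h \<le> prob (csublevel (u i))" for i using u(2) by (auto simp: S_def)
  ultimately have ge: "h \<le> prob (csublevel r0)" by (metis LIMSEQ_le_const)
  have "- \<infinity> \<in> {..<r0}" using r0 by (cases r0) auto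
  then obtain v where v: "incseq v" "range v \<subseteq> {..<r0}" "Sup {..<r0} = (SUP i. v i)"
    using Sup_countable_SUP[of "{..<r0}"] by blast
  have sup: "r0 = (SUP i. v i)"
    using v(3) Sup_lessThan[of r0] r0 by auto
  have "sublevel r0 = (\<Union>i. sublevel (v i))"
    by (auto simp: sublevel_def sup less_SUP_iff)
  moreover have "(\<lambda>i. prob (sublevel (v i))) \<longlonglongrightarrow> prob (\<Union>i. sublevel (v i))"
    using v(1) by (intro finite_Lim_measure_incseq)
      (auto simp: incseq_def sublevel_def intro: less_le_trans)
  moreover have "prob (sublevel (v i)) \<le> h" for i
  proof (cases "0 \<le> v i")
    case True
    have "v i < r0" using v(2) by auto
    then have "v i \<notin> S" using Inf_lower[of "v i" S] by (auto simp: r0_def)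
    then have "prob (csublevel (v i)) < h" using True by (simp add: S_def)
    moreover have "prob (sublevel (v i)) \<le> prob (csublevel (v i))"
      by (intro finite_measure_mono) (auto simp: sublevel_def csublevel_def)
    ultimately show ?thesis by simp
  next
    case False
    have "0 \<le> ereal (sqrt (cost x))" for x by simp
    with False have "sublevel (v i) = {}"
      by (auto simp: sublevel_def not_less not_le intro: order_trans less_imp_le)
    then show ?thesis using h by simp
  qed
  ultimately have le: "prob (sublevel r0) \<le> h" by (metis LIMSEQ_le_const2)
  have "trim_radius \<Omega> \<phi> P h c = r0"
    unfolding trim_radius_def completion_balls
  proof (rule Least_equality)
    show "0 \<le> r0 \<and> prob (sublevel r0) \<le> h \<and> h \<le> prob (csublevel r0)" using r0 le ge by blast
    show "r0 \<le> y" if "0 \<le> y \<and> prob (sublevel y) \<le> h \<and> h \<le> prob (csublevel y)" for y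
      unfolding r0_def using that by (intro Inf_lower) (simp add: S_def)
  qed
  with r0 le ge show "0 \<le> r" "prob (sublevel r) \<le> h" "h \<le> prob (csublevel r)"
    by (simp_all add: r_def)
qed

text \<open>The measure with density \<open>w / h\<close>, for a trimming weight \<open>w\<close>
  between the open and the closed sublevel, qualifies. Hence the choice in
  \<open>trimmed_distortion\<close> has a genuine member to pick.\<close>

lemma trimmed_measures_code_nonempty:
  assumes h: "0 < h" "h \<le> 1"
  shows "trimmed_measures_code \<Omega> \<phi> P h c \<noteq> {}"
proof -
  define r where "r = trim_radius \<Omega> \<phi> P h c"
  note r = trim_radius_quantile[OF h, folded r_def]
  have "sublevel r \<subseteq> csublevel r" by (auto simp: sublevel_def csublevel_def)
  then obtain w where w: "w \<in> borel_measurable P" "\<And>x. 0 \<le> w x" "\<And>x. w x \<le> 1"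
    "\<And>x. x \<in> sublevel r \<Longrightarrow> w x = 1" "\<And>x. x \<notin> csublevel r \<Longrightarrow> w x = 0" "expectation w = h"
    using trimming_weight[of "sublevel r" "csublevel r" h] r by auto
  note [measurable] = w(1)
  define Q where "Q = density P (\<lambda>x. ennreal (w x))"
  have sets_Q: "sets Q = sets borel" by (simp add: Q_def sets_P)
  have Q: "emeasure Q A = (\<integral>\<^sup>+x. ennreal (w x) * indicator A x \<partial>P)" if "A \<in> sets borel" for A
    unfolding Q_def using that sets_P by (intro emeasure_density) auto
  have Q_le: "emeasure Q A \<le> emeasure P A" if A: "A \<in> sets borel" for A
  proof -
    have "emeasure Q A \<le> (\<integral>\<^sup>+x. indicator A x \<partial>P)"
      unfolding Q[OF A] using w(2,3) by (intro nn_integral_mono) (auto simp: indicator_def)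
    then show ?thesis using A sets_P by simp
  qed
  have int: "integrable P w"
    using w(2,3) by (intro integrable_const_bound[of _ 1]) auto
  have "emeasure Q UNIV = ennreal h"
    using nn_integral_eq_integral[OF int] w(2,6) by (simp add: Q)
  then have trimmed: "scale_measure (ennreal (1 / h)) Q \<in> trimmed_measures P h"
    using sets_Q Q_le by (auto simp: trimmed_measures_def)
  have "emeasure (scale_measure (ennreal (1 / h)) Q) A = emeasure P A / ennreal h"
    if A: "A \<in> sets borel" "A \<subseteq> breg_ball \<Omega> \<phi> c r" for A
  proof -
    have "AE x in P. ennreal (w x) * indicator A x = indicator A x"
      using AE_F A(2) w(4) by (auto simp: sublevel_eq indicator_def)
    then have "emeasure Q A = (\<integral>\<^sup>+x. indicator A x \<partial>P)"
      unfolding Q[OF A(1)] by (rule nn_integral_cong_AE)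
    then show ?thesis using A sets_P h
      by (simp add: divide_ennreal_def inverse_ennreal mult.commute inverse_eq_divide)
  qed
  moreover have "measure_support (scale_measure (ennreal (1 / h)) Q) \<subseteq> breg_cball \<Omega> \<phi> c r"
  proof
    fix x assume x: "x \<in> measure_support (scale_measure (ennreal (1 / h)) Q)"
    have "open (- csublevel r)" using closed_csublevel by auto
    moreover have "emeasure Q (- csublevel r) = 0"
    proof -
      have "emeasure Q (- csublevel r) = (\<integral>\<^sup>+x. ennreal (w x) * indicator (- csublevel r) x \<partial>P)"
        using closed_csublevel by (intro Q) auto
      also have "\<dots> = (\<integral>\<^sup>+x. 0 \<partial>P)"
        using w(5) by (intro nn_integral_cong) (auto simp: indicator_def)
      finally show ?thesis by simp
    qed
    ultimately have "x \<notin> - csublevel r" using x by (force simp: measure_support_def)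
    then show "x \<in> breg_cball \<Omega> \<phi> c r" by (simp add: csublevel_eq)
  qed
  ultimately have "scale_measure (ennreal (1 / h)) Q \<in> trimmed_measures_code \<Omega> \<phi> P h c"
    using trimmed by (simp add: trimmed_measures_code_def r_def)
  then show ?thesis by blast
qed

lemma integrable_excess: "0 \<le> t \<Longrightarrow> integrable P (\<lambda>x. max 0 (t - cost x))"
  by (rule integrable_const_bound[of _ t]) auto

lemma excess_nonneg: "0 \<le> excess F \<Omega> \<phi> P c t"
  unfolding excess_def by (rule Bochner_Integration.integral_nonneg) simp

lemma nn_integral_excess:
  "0 \<le> t \<Longrightarrow> (\<integral>\<^sup>+x. ennreal (max 0 (t - cost x)) \<partial>P) = ennreal (excess F \<Omega> \<phi> P c t)"
  unfolding excess_def by (rule nn_integral_eq_integral[OF integrable_excess]) auto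

lemma sets_cost_sublevel [measurable]:
  "{x \<in> F. cost x < t} \<in> sets P" "{x \<in> F. cost x \<le> t} \<in> sets P"
proof -
  have "F \<inter> {x \<in> space P. cost x < t} \<in> sets P" "F \<inter> {x \<in> space P. cost x \<le> t} \<in> sets P"
    by measurable
  moreover have "{x \<in> F. cost x < t} = F \<inter> {x \<in> space P. cost x < t}"
    "{x \<in> F. cost x \<le> t} = F \<inter> {x \<in> space P. cost x \<le> t}" by (auto simp: space_P)
  ultimately show "{x \<in> F. cost x < t} \<in> sets P" "{x \<in> F. cost x \<le> t} \<in> sets P" by simp_all
qed

lemma excess_le:
  assumes "0 \<le> t"
  shows "excess F \<Omega> \<phi> P c t \<le> t * prob {x \<in> F. cost x < t}"
proof -
  have "excess F \<Omega> \<phi> P c t \<le> (\<integral>x. t * indicator {x \<in> F. cost x < t} x \<partial>P)"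
    unfolding excess_def
  proof (rule integral_mono_AE)
    show "integrable P (\<lambda>x. max 0 (t - cost x))" using assms by (rule integrable_excess)
    show "integrable P (\<lambda>x. t * indicat_real {x \<in> F. cost x < t} x)"
      by (simp add: emeasure_eq_measure)
    show "AE x in P. max 0 (t - cost x) \<le> t * indicat_real {x \<in> F. cost x < t} x"
      using AE_F by eventually_elim (use assms in \<open>auto simp: indicator_def\<close>)
  qed
  also have "\<dots> = t * prob {x \<in> F. cost x < t}" by simp
  finally show ?thesis .
qed

text \<open>Undoes the normalisation by \<open>h\<close>. The last clause is weak duality for
  \<open>Q\<close>: integrate \<open>t \<le> cost x + max 0 (t - cost x)\<close> against
  \<open>Q\<close>, which has mass \<open>h\<close>.\<close>

lemma trimmed_measures_decomp:
  assumes "P' \<in> trimmed_measures P h" "0 < h"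
  obtains Q where "P' = scale_measure (ennreal (1 / h)) Q" "sets Q = sets borel" "Q \<le> P"
    "emeasure Q UNIV = ennreal h" "AE x in Q. x \<in> F"
    "ennreal h * (\<integral>\<^sup>+u. ennreal (bregman_code \<Omega> \<phi> u c) \<partial>P') = (\<integral>\<^sup>+u. ennreal (cost u) \<partial>Q)"
    "\<And>t. 0 \<le> t \<Longrightarrow> ennreal (h * t) \<le> (\<integral>\<^sup>+u. ennreal (cost u) \<partial>Q) + (\<integral>\<^sup>+x. ennreal (max 0 (t - cost x)) \<partial>Q)"
proof -
  obtain Q where Q: "P' = scale_measure (ennreal (1 / h)) Q" "sets Q = sets borel"
    "\<And>A. A \<in> sets borel \<Longrightarrow> emeasure Q A \<le> emeasure P A" "emeasure Q UNIV = ennreal h"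
    using assms(1) by (auto simp: trimmed_measures_def)
  have space_Q: "space Q = UNIV" using sets_eq_imp_space_eq[OF Q(2)] by simp
  have [measurable]: "cost \<in> borel_measurable Q"
    using measurable_cost by (simp add: measurable_cong_sets[OF Q(2) refl])
  have "Q \<le> P"
    using Q(2,3) sets_P by (auto simp: le_measure_iff space_P space_Q le_fun_def)
      (metis emeasure_notin_sets le_zero_eq order_refl sets_P)
  have "emeasure P (- F) = 0"
    using AE_F F_in_P by (subst (asm) AE_iff_measurable[of "- F"]) (auto simp: space_P sets_P)
  then have "emeasure Q (- F) = 0" using Q(3)[of "- F"] borel_F by auto
  then have "- F \<in> null_sets Q" "- F \<in> null_sets P'"
    using Q(1,2) borel_F by (auto simp: null_sets_def)
  then have AE_Q: "AE x in Q. x \<in> F" and AE_P': "AE x in P'. x \<in> F"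
    by (auto intro: AE_I'[of "- F"])
  have "(\<integral>\<^sup>+u. ennreal (bregman_code \<Omega> \<phi> u c) \<partial>P') = (\<integral>\<^sup>+u. ennreal (cost u) \<partial>P')"
    using AE_P' by (intro nn_integral_cong_AE) (auto simp: cost_on_def)
  also have "\<dots> = ennreal (1 / h) * (\<integral>\<^sup>+u. ennreal (cost u) \<partial>Q)"
    unfolding Q(1) by (intro nn_integral_scale_measure) measurable
  finally have "ennreal h * (\<integral>\<^sup>+u. ennreal (bregman_code \<Omega> \<phi> u c) \<partial>P') = (\<integral>\<^sup>+u. ennreal (cost u) \<partial>Q)"
    using \<open>0 < h\<close> by (simp add: mult.assoc[symmetric] ennreal_mult[symmetric])
  moreover have "ennreal (h * t) \<le> (\<integral>\<^sup>+u. ennreal (cost u) \<partial>Q) + (\<integral>\<^sup>+x. ennreal (max 0 (t - cost x)) \<partial>Q)"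
    if t: "0 \<le> t" for t
  proof -
    have le: "ennreal t \<le> ennreal (cost x) + ennreal (max 0 (t - cost x))" for x
    proof -
      have "ennreal t \<le> ennreal (cost x + max 0 (t - cost x))" by (intro ennreal_leI) simp
      then show ?thesis by (subst (asm) ennreal_plus) auto
    qed
    have "ennreal (h * t) = (\<integral>\<^sup>+x. ennreal t \<partial>Q)"
      using \<open>0 < h\<close> t Q(4) by (simp add: space_Q ennreal_mult mult.commute)
    also have "\<dots> \<le> (\<integral>\<^sup>+x. ennreal (cost x) + ennreal (max 0 (t - cost x)) \<partial>Q)"
      by (intro nn_integral_mono le)
    also have "\<dots> = (\<integral>\<^sup>+u. ennreal (cost u) \<partial>Q) + (\<integral>\<^sup>+x. ennreal (max 0 (t - cost x)) \<partial>Q)"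
      by (intro nn_integral_add) auto
    finally show ?thesis .
  qed
  ultimately show thesis using that Q \<open>Q \<le> P\<close> AE_Q by blast
qed

lemma trimmed_distortion_eq_some:
  assumes "0 < h" "h \<le> 1"
  obtains P' where "P' \<in> trimmed_measures_code \<Omega> \<phi> P h c"
    "trimmed_distortion \<Omega> \<phi> P h c = ennreal h * (\<integral>\<^sup>+u. ennreal (bregman_code \<Omega> \<phi> u c) \<partial>P')"
proof -
  have "(SOME P'. P' \<in> trimmed_measures_code \<Omega> \<phi> P h c) \<in> trimmed_measures_code \<Omega> \<phi> P h c"
    using trimmed_measures_code_nonempty[OF assms] by (simp add: some_in_eq)
  then show thesis using assms that by (simp add: trimmed_distortion_def)
qed

text \<open>Since \<open>Q \<le> P\<close>, the excess under \<open>Q\<close> in weak duality is at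
  most the excess under \<open>P\<close>. A negative left side is harmless because
  \<open>ennreal\<close> sends it to 0.\<close>

lemma trimmed_distortion_ge:
  assumes h: "0 < h" "h \<le> 1" and t: "0 \<le> t"
  shows "ennreal (h * t - excess F \<Omega> \<phi> P c t) \<le> trimmed_distortion \<Omega> \<phi> P h c"
proof -
  obtain P' where P': "P' \<in> trimmed_measures_code \<Omega> \<phi> P h c"
    "trimmed_distortion \<Omega> \<phi> P h c = ennreal h * (\<integral>\<^sup>+u. ennreal (bregman_code \<Omega> \<phi> u c) \<partial>P')"
    by (rule trimmed_distortion_eq_some[OF h])
  then have "P' \<in> trimmed_measures P h" by (simp add: trimmed_measures_code_def)
  then obtain Q where Q: "sets Q = sets borel" "Q \<le> P"
    "ennreal h * (\<integral>\<^sup>+u. ennreal (bregman_code \<Omega> \<phi> u c) \<partial>P') = (\<integral>\<^sup>+u. ennreal (cost u) \<partial>Q)"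
    "ennreal (h * t) \<le> (\<integral>\<^sup>+u. ennreal (cost u) \<partial>Q) + (\<integral>\<^sup>+x. ennreal (max 0 (t - cost x)) \<partial>Q)"
    using h t by (elim trimmed_measures_decomp) auto
  have "(\<integral>\<^sup>+x. ennreal (max 0 (t - cost x)) \<partial>Q) \<le> ennreal (excess F \<Omega> \<phi> P c t)"
    using nn_integral_mono_measure[of Q P] Q(1,2) sets_P nn_integral_excess[OF t] by metis
  with Q(4) have "ennreal (h * t) \<le> (\<integral>\<^sup>+u. ennreal (cost u) \<partial>Q) + ennreal (excess F \<Omega> \<phi> P c t)"
    by (meson add_left_mono order_trans)
  then show ?thesis
    unfolding P'(2) Q(3)
    by (simp add: ennreal_minus[OF excess_nonneg, symmetric] ennreal_minus_le_iff add.commute)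
qed

text \<open>Weak duality is an equality at the squared trimming radius: the support condition gives
  \<open>cost x \<le> t\<close> almost everywhere for \<open>Q\<close>, and the excess only sees the
  open sublevel, where \<open>Q\<close> and \<open>P\<close> agree.\<close>

lemma trimmed_distortion_eq:
  assumes h: "0 < h" "h < 1"
  obtains t where "0 \<le> t" "prob {x \<in> F. cost x < t} \<le> h" "h \<le> prob {x \<in> F. cost x \<le> t}"
    "trimmed_distortion \<Omega> \<phi> P h c = ennreal (h * t - excess F \<Omega> \<phi> P c t)"
proof -
  define r where "r = trim_radius \<Omega> \<phi> P h c"
  have h': "h \<le> 1" using h by simp
  note r = trim_radius_quantile[OF h(1) h', folded r_def]
  \<comment> \<open>An infinite radius would make the open sublevel all of \<open>F\<close>, whose
    mass 1 exceeds \<open>h\<close>.\<close>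
  have "r \<noteq> \<infinity>"
  proof
    assume "r = \<infinity>"
    then have "sublevel r = F" by (auto simp: sublevel_def)
    then show False using r(2) h prob_F by simp
  qed
  then obtain \<rho> where \<rho>: "r = ereal \<rho>" "0 \<le> \<rho>" using r(1) by (cases r) auto
  define t where "t = \<rho>\<^sup>2"
  have t: "0 \<le> t" "\<rho> = sqrt t" using \<rho> by (simp_all add: t_def)
  have sub: "sublevel r = {x \<in> F. cost x < t}" "csublevel r = {x \<in> F. cost x \<le> t}"
    by (simp_all add: sublevel_def csublevel_def \<rho>(1) t(2))
  obtain P' where P': "P' \<in> trimmed_measures_code \<Omega> \<phi> P h c"
    "trimmed_distortion \<Omega> \<phi> P h c = ennreal h * (\<integral>\<^sup>+u. ennreal (bregman_code \<Omega> \<phi> u c) \<partial>P')"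
    by (rule trimmed_distortion_eq_some[OF h(1) h'])
  then have "P' \<in> trimmed_measures P h" by (simp add: trimmed_measures_code_def)
  then obtain Q where Q: "P' = scale_measure (ennreal (1 / h)) Q" "sets Q = sets borel"
    "emeasure Q UNIV = ennreal h" "AE x in Q. x \<in> F"
    "ennreal h * (\<integral>\<^sup>+u. ennreal (bregman_code \<Omega> \<phi> u c) \<partial>P') = (\<integral>\<^sup>+u. ennreal (cost u) \<partial>Q)"
    using h(1) by (elim trimmed_measures_decomp) auto
  have space_Q: "space Q = UNIV" using sets_eq_imp_space_eq[OF Q(2)] by simp
  have [measurable]: "cost \<in> borel_measurable Q"
    using measurable_cost by (simp add: measurable_cong_sets[OF Q(2) refl])
  have subQ [measurable]: "sublevel r \<in> sets Q" using sets_sublevel sets_P Q(2) by metis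
  have "AE x in P'. x \<in> measure_support P'"
    by (rule AE_measure_support) (simp add: Q)
  then have "AE x in P'. x \<in> breg_cball \<Omega> \<phi> c r"
    using P'(1) by (auto simp: trimmed_measures_code_def r_def)
  then have "AE x in Q. x \<in> breg_cball \<Omega> \<phi> c r"
    unfolding Q(1) eventually_ae_filter using h(1)
    by (auto simp: null_sets_def space_scale_measure ennreal_eq_0_iff)
  with Q(4) have AE_le: "AE x in Q. cost x \<le> t"
  proof eventually_elim
    case (elim x)
    then have "x \<in> csublevel r" by (simp add: csublevel_eq)
    then show ?case by (simp add: sub)
  qed
  \<comment> \<open>Coincidence with \<open>P / h\<close> on the open ball concerns the normalised
    measure; cancelling \<open>1 / h\<close> yields that \<open>Q\<close> and \<open>P\<close> agree
    there.\<close>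
  have eq_dens: "density Q (indicator (sublevel r)) = density P (indicator (sublevel r))"
  proof (rule measure_eqI)
    show "sets (density Q (indicator (sublevel r))) = sets (density P (indicator (sublevel r)))"
      by (simp add: Q sets_P)
    fix A assume "A \<in> sets (density Q (indicator (sublevel r)))"
    then have A: "A \<in> sets borel" by (simp add: Q)
    have "sublevel r \<inter> A \<in> sets borel" using A subQ Q(2) by blast
    moreover have "sublevel r \<inter> A \<subseteq> breg_ball \<Omega> \<phi> c r" by (auto simp: sublevel_eq)
    ultimately have "emeasure P' (sublevel r \<inter> A) = emeasure P (sublevel r \<inter> A) / ennreal h"
      using P'(1) by (auto simp: trimmed_measures_code_def r_def)
    then have "ennreal (1 / h) * emeasure Q (sublevel r \<inter> A) = ennreal (1 / h) * emeasure P (sublevel r \<inter> A)"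
      using h(1) by (simp add: Q(1) divide_ennreal_def inverse_ennreal mult.commute inverse_eq_divide)
    then have "emeasure Q (sublevel r \<inter> A) = emeasure P (sublevel r \<inter> A)"
      using h(1) by (simp add: ennreal_mult_cancel_left)
    then show "emeasure (density Q (indicator (sublevel r))) A = emeasure (density P (indicator (sublevel r))) A"
      using A Q(2) sets_P by (simp add: emeasure_density indicator_inter_arith[symmetric])
  qed
  have restr: "(\<integral>\<^sup>+x. ennreal (max 0 (t - cost x)) \<partial>M) = (\<integral>\<^sup>+x. ennreal (max 0 (t - cost x)) \<partial>(density M (indicator (sublevel r))))"
    if M: "sets M = sets borel" "AE x in M. x \<in> F" for M
  proof -
    have [measurable]: "cost \<in> borel_measurable M" "sublevel r \<in> sets M"
      using measurable_cost subQ Q(2) M(1) by (simp_all add: measurable_cong_sets[OF M(1) refl])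
    have "(\<integral>\<^sup>+x. ennreal (max 0 (t - cost x)) \<partial>M) = (\<integral>\<^sup>+x. indicator (sublevel r) x * ennreal (max 0 (t - cost x)) \<partial>M)"
      using M(2) by (intro nn_integral_cong_AE) (auto simp: sub indicator_def ennreal_neg)
    also have "\<dots> = (\<integral>\<^sup>+x. ennreal (max 0 (t - cost x)) \<partial>(density M (indicator (sublevel r))))"
      by (intro nn_integral_density[symmetric]) measurable
    finally show ?thesis .
  qed
  have exc: "(\<integral>\<^sup>+x. ennreal (max 0 (t - cost x)) \<partial>Q) = ennreal (excess F \<Omega> \<phi> P c t)"
    using restr[OF Q(2,4)] restr[OF sets_P AE_F] nn_integral_excess[OF t(1)] eq_dens by simp
  have split: "ennreal t = ennreal (cost x) + ennreal (max 0 (t - cost x))" if "cost x \<le> t" for x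
  proof -
    have "ennreal (cost x + max 0 (t - cost x)) = ennreal (cost x) + ennreal (max 0 (t - cost x))"
      by (rule ennreal_plus) simp_all
    then show ?thesis using that by (simp add: max_absorb2)
  qed
  have "ennreal (h * t) = (\<integral>\<^sup>+x. ennreal t \<partial>Q)"
    using h(1) t(1) Q(3) by (simp add: space_Q ennreal_mult mult.commute)
  also have "\<dots> = (\<integral>\<^sup>+x. ennreal (cost x) + ennreal (max 0 (t - cost x)) \<partial>Q)"
    by (intro nn_integral_cong_AE eventually_mono[OF AE_le split])
  also have "\<dots> = (\<integral>\<^sup>+u. ennreal (cost u) \<partial>Q) + ennreal (excess F \<Omega> \<phi> P c t)"
    unfolding exc[symmetric] by (intro nn_integral_add) auto
  finally have "(\<integral>\<^sup>+u. ennreal (cost u) \<partial>Q) = ennreal (h * t - excess F \<Omega> \<phi> P c t)"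
    by (simp add: ennreal_minus[OF excess_nonneg, symmetric])
  then show thesis using that[OF t(1)] r(2,3) unfolding sub P'(2) Q(5) by simp
qed

text \<open>A primal optimiser in the form of a weight: 1 where the cost is below \<open>t\<close>,
  0 where it is above. Being a function, it can be evaluated at sample points, and the weighted cost
  is bounded, as concentration demands.\<close>

lemma weighted_cost:
  assumes "0 < h" "h < 1"
  obtains t w where "0 \<le> t" "w \<in> borel_measurable borel" "\<And>x. 0 \<le> w x" "\<And>x. w x \<le> 1"
    "expectation w = h" "expectation (\<lambda>x. w x * cost x) = h * t - excess F \<Omega> \<phi> P c t"
    "\<And>x. w x * cost x \<le> t"
proof -
  obtain t where t: "0 \<le> t" "prob {x \<in> F. cost x < t} \<le> h" "h \<le> prob {x \<in> F. cost x \<le> t}"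
    by (rule trimmed_distortion_eq[OF assms])
  have "{x \<in> F. cost x < t} \<subseteq> {x \<in> F. cost x \<le> t}" by auto
  then obtain w where w: "w \<in> borel_measurable P" "\<And>x. 0 \<le> w x" "\<And>x. w x \<le> 1"
    "\<And>x. x \<in> {x \<in> F. cost x < t} \<Longrightarrow> w x = 1" "\<And>x. x \<notin> {x \<in> F. cost x \<le> t} \<Longrightarrow> w x = 0"
    "expectation w = h"
    using trimming_weight[OF sets_cost_sublevel _ t(2,3)] by blast
  note [measurable] = w(1)
  have int: "integrable P w"
    using w(2,3) by (intro integrable_const_bound[of _ 1]) auto
  have le: "w x * cost x \<le> t" for x
  proof (cases "x \<in> {x \<in> F. cost x \<le> t}")
    case True
    then have "w x * cost x \<le> 1 * t" using w(3) t(1) by (intro mult_mono) auto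
    then show ?thesis by simp
  qed (use w(5) t(1) in auto)
  have "expectation (\<lambda>x. w x * cost x) = expectation (\<lambda>x. t * w x - max 0 (t - cost x))"
  proof (intro integral_cong_AE)
    show "AE x in P. w x * cost x = t * w x - max 0 (t - cost x)"
      using AE_F
    proof eventually_elim
      case (elim x)
      then show ?case
        by (cases "cost x < t"; cases "cost x = t") (auto simp: w(4,5))
    qed
  qed measurable
  also have "\<dots> = h * t - excess F \<Omega> \<phi> P c t"
    unfolding excess_def using int integrable_excess[OF t(1)] w(6) by simp
  finally show thesis
    using that[of t w] t(1) w le by (simp add: measurable_cong_sets[OF sets_P refl])
qed

text \<open>
  The level has to be truncated at \<open>T\<close> because only costs truncated at a common height form a totally
  bounded class; the gap between \<open>h\<close> and \<open>H\<close> pays for the truncation.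
\<close>

lemma truncated_level:
  assumes h: "0 < h" "h < H" "h < 1" and R: "0 \<le> R" "ennreal R \<le> trimmed_distortion \<Omega> \<phi> P h c"
  obtains t where "0 \<le> t" "t \<le> 2 * R / (H - h)" "R \<le> (H + h) / 2 * t - excess F \<Omega> \<phi> P c t"
proof -
  obtain t where t: "0 \<le> t" "prob {x \<in> F. cost x < t} \<le> h"
    "trimmed_distortion \<Omega> \<phi> P h c = ennreal (h * t - excess F \<Omega> \<phi> P c t)"
    by (rule trimmed_distortion_eq[OF h(1,3)])
  \<comment> \<open>At this height the extra level \<open>(H - h) / 2\<close> alone yields
    \<open>R\<close>, so a larger optimal \<open>t\<close> can be replaced by
    \<open>T\<close>.\<close>
  define T where "T = 2 * R / (H - h)"
  have T: "0 \<le> T" using R h by (simp add: T_def)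
  show thesis
  proof (cases "t \<le> T")
    case True
    \<comment> \<open>Needed to read the \<open>ennreal\<close> inequality in the reals, as negative
      values would be clipped to 0.\<close>
    have "0 \<le> h * t - excess F \<Omega> \<phi> P c t"
      using excess_le[OF t(1)] t(1,2) mult_left_mono[OF t(2) t(1)] by (simp add: mult.commute)
    then have "R \<le> h * t - excess F \<Omega> \<phi> P c t" using R t(3) by simp
    moreover have "h * t \<le> (H + h) / 2 * t" using h t(1) by (intro mult_right_mono) auto
    ultimately show thesis using that[of t] t(1) True by (simp add: T_def)
  next
    case False
    then have "prob {x \<in> F. cost x < T} \<le> prob {x \<in> F. cost x < t}"
      by (intro finite_measure_mono) auto
    then have "T * prob {x \<in> F. cost x < T} \<le> T * h" using T t(2) by (intro mult_left_mono) auto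
    then have "excess F \<Omega> \<phi> P c T \<le> T * h" using excess_le[OF T] by simp
    moreover have "R + T * h = (H + h) / 2 * T" using h by (simp add: T_def field_simps)
    ultimately show thesis using that[of T] T by (simp add: T_def)
  qed
qed

end

section \<open>Concentration and empirical measures\<close>

text \<open>Each function deviates with probability at most \<open>exp (- (\<kappa> * n))\<close>,
  and the union bound over the finite class still beats any power of \<open>n\<close>. The threshold
  for \<open>n\<close> depends only on the class, \<open>B\<close>, \<open>e\<close> and
  \<open>q\<close>, hence serves every sample space.\<close>

lemma hoeffding_finite_class:
  fixes P :: "'a::topological_space measure" and G :: "('a \<Rightarrow> real) set"
  assumes G: "finite G" "\<And>g. g \<in> G \<Longrightarrow> g \<in> borel_measurable borel"
    "\<And>g x. g \<in> G \<Longrightarrow> \<bar>g x\<bar> \<le> B" and e: "0 < e"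
    and F: "F \<in> sets borel" "AE x in P. x \<in> F"
  shows "\<forall>\<^sub>F n in sequentially. \<forall>(M :: 'w measure) X. prob_space M \<longrightarrow>
      prob_space.indep_vars M (\<lambda>_. borel) X {..<n} \<longrightarrow> (\<forall>i<n. distr M borel (X i) = P) \<longrightarrow>
      (\<exists>E\<in>sets M. 1 - n powr - q < measure M E \<and> (\<forall>\<omega>\<in>E. (\<forall>i<n. X i \<omega> \<in> F) \<and>
        (\<forall>g\<in>G. (\<Sum>i<n. g (X i \<omega>)) / n < (\<integral>x. g x \<partial>P) + e)))"
proof -
  define b where "b = \<bar>B\<bar> + 1"
  have b: "0 < b" "\<And>g x. g \<in> G \<Longrightarrow> g x \<in> {- b..b}"
  proof -
    show "0 < b" by (simp add: b_def)
    show "g x \<in> {- b..b}" if "g \<in> G" for g x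
      using G(3)[OF that, of x] by (auto simp: b_def)
  qed
  define \<kappa> where "\<kappa> = 2 * e\<^sup>2 / (b - - b)\<^sup>2"
  have "0 < \<kappa>" using e b by (simp add: \<kappa>_def)
  \<comment> \<open>The added 1 keeps \<open>m\<close> positive for an empty class.\<close>
  define m where "m = real (card G) + 1"
  have m: "0 < m" by (simp add: m_def)
  have "\<forall>\<^sub>F n in sequentially. m * exp (- (\<kappa> * real n)) < real n powr - q"
    using \<open>0 < \<kappa>\<close> m by real_asymp
  then show ?thesis using eventually_gt_at_top[of "0::nat"]
  proof eventually_elim
    case (elim n)
    show ?case
    proof (intro allI impI)
      fix M :: "'w measure" and X :: "nat \<Rightarrow> 'w \<Rightarrow> 'a"
      assume M: "prob_space M" and ind: "prob_space.indep_vars M (\<lambda>_. borel) X {..<n}"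
        and dist: "\<forall>i<n. distr M borel (X i) = P"
      interpret prob_space M by fact
      have X: "X i \<in> borel_measurable M" if "i < n" for i
        using ind that by (auto simp: indep_vars_def)
      define A where "A g = {\<omega> \<in> space M. (\<integral>x. g x \<partial>P) + e \<le> (\<Sum>i<n. g (X i \<omega>)) / n}" for g
      have A: "A g \<in> events \<and> prob (A g) \<le> exp (- (\<kappa> * real n))" if g: "g \<in> G" for g
      proof -
        have gX [measurable]: "(\<lambda>\<omega>. g (X i \<omega>)) \<in> borel_measurable M" if "i < n" for i
          using X[OF that] G(2)[OF g] by measurable
        have dg: "distr M borel (\<lambda>\<omega>. g (X i \<omega>)) = distr P borel g" if "i < n" for i
          using distr_distr[OF G(2)[OF g] X[OF that]] dist that by (simp add: o_def)
        have mean: "expectation (\<lambda>\<omega>. g (X 0 \<omega>)) = (\<integral>x. g x \<partial>P)"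
          using integral_distr[OF X[OF elim(2)] G(2)[OF g]] dist elim(2) by simp
        interpret H: Hoeffding_ineq_iid M "{..<n}" "\<lambda>i \<omega>. g (X i \<omega>)" "\<lambda>\<omega>. g (X 0 \<omega>)" "- b" b
          "expectation (\<lambda>\<omega>. g (X 0 \<omega>))"
        proof unfold_locales
          show "indep_vars (\<lambda>_. borel) (\<lambda>i \<omega>. g (X i \<omega>)) {..<n}"
            by (rule indep_vars_compose2[OF ind]) (use G(2) g in auto)
          show "distr M borel (\<lambda>\<omega>. g (X i \<omega>)) = distr M borel (\<lambda>\<omega>. g (X 0 \<omega>))" if "i \<in> {..<n}" for i
            using dg that elim by simp
          show "(\<lambda>\<omega>. g (X 0 \<omega>)) \<in> borel_measurable M" using gX elim by simp
          show "AE x in M. g (X 0 x) \<in> {- b..b}" using b(2)[OF g] by simp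
        qed simp_all
        have "A g \<in> events" unfolding A_def by measurable
        then show ?thesis
          using H.Hoeffding_ineq_ge'[of e] e b(1) elim unfolding mean A_def \<kappa>_def
          by (simp add: lessThan_empty_iff mult_ac)
      qed
      have sets_A: "(\<Union>g\<in>G. A g) \<in> events" using A G(1) by (intro sets.finite_UN) auto
      have "prob (\<Union>g\<in>G. A g) \<le> (\<Sum>g\<in>G. prob (A g))"
        using A G(1) by (intro finite_measure_subadditive_finite) auto
      also have "\<dots> \<le> (\<Sum>g\<in>G. exp (- (\<kappa> * real n)))"
        using A by (intro sum_mono) auto
      also have "\<dots> \<le> m * exp (- (\<kappa> * real n))"
        by (simp add: m_def)
      also have "\<dots> < real n powr - q" using elim by simp
      finally have small: "prob (\<Union>g\<in>G. A g) < real n powr - q" .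
      \<comment> \<open>Samples that leave \<open>F\<close> form a null event, so excluding them
        costs no probability.\<close>
      define E where "E = {\<omega> \<in> space M. \<forall>i\<in>{..<n}. X i \<omega> \<in> F} - (\<Union>g\<in>G. A g)"
      have "{\<omega> \<in> space M. \<forall>i\<in>{..<n}. X i \<omega> \<in> F} \<in> events"
        using measurable_sets[OF X F(1)]
        by (intro sets.sets_Collect_finite_All) (auto simp: vimage_def Int_def conj_commute)
      then have sets_E: "E \<in> events" using sets_A by (simp add: E_def)
      have "AE \<omega> in M. X i \<omega> \<in> F" if "i < n" for i
      proof -
        have eq: "distr M borel (X i) = P" using dist that by blast
        have "AE x in distr M borel (X i). x \<in> F" unfolding eq by (rule F(2))
        then show ?thesis using F(1) by (subst (asm) AE_distr_iff[OF X[OF that]]) auto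
      qed
      then have "AE \<omega> in M. \<forall>i\<in>{..<n}. X i \<omega> \<in> F" by (intro AE_finite_allI) auto
      then have "prob E = prob (space M - (\<Union>g\<in>G. A g))"
        using sets_E sets_A by (intro measure_eq_AE) (auto simp: E_def)
      also have "\<dots> = 1 - prob (\<Union>g\<in>G. A g)" using sets_A by (rule prob_compl)
      finally have "1 - n powr - q < prob E" using small by simp
      then show "\<exists>E\<in>events. 1 - n powr - q < prob E \<and> (\<forall>\<omega>\<in>E. (\<forall>i<n. X i \<omega> \<in> F) \<and>
        (\<forall>g\<in>G. (\<Sum>i<n. g (X i \<omega>)) / n < (\<integral>x. g x \<partial>P) + e))"
        using sets_E by (intro bexI[of _ E]) (auto simp: E_def A_def not_le)
    qed
  qed
qed

lemma measurable_nth_uniform_count: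
  "(\<lambda>i. zs ! i) \<in> measurable (uniform_count_measure {..<length zs}) borel"
  by (auto simp: measurable_def space_uniform_count_measure sets_uniform_count_measure)

lemma integral_empirical_measure:
  fixes f :: "'a::euclidean_space \<Rightarrow> real"
  assumes "f \<in> borel_measurable borel"
  shows "(\<integral>x. f x \<partial>empirical_measure zs) = sum_list (map f zs) / length zs"
  unfolding empirical_measure_def
  by (subst integral_distr[OF measurable_nth_uniform_count assms])
    (simp add: integral_uniform_count_measure sum_list_sum_nth lessThan_atLeast0)

text \<open>A finite set is closed, so the sample points themselves serve as carrier, wherever in
  \<open>\<Omega>\<close> the adversary puts them.\<close>

lemma carried_code_empirical_measure:
  assumes "zs \<noteq> []" "set zs \<subseteq> \<Omega>" "strictly_convex_on \<Omega> \<phi>" "\<phi> differentiable_on \<Omega>"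
    "c \<noteq> []" "set c \<subseteq> \<Omega>"
  shows "carried_code (empirical_measure zs) (set zs) \<Omega> \<phi> c"
proof -
  interpret U: prob_space "uniform_count_measure {..<length zs}"
    using assms(1) by (intro prob_space_uniform_count_measure) auto
  interpret prob_space "empirical_measure zs"
    unfolding empirical_measure_def by (rule U.prob_space_distr[OF measurable_nth_uniform_count])
  show ?thesis
  proof unfold_locales
    show "AE x in empirical_measure zs. x \<in> set zs"
      unfolding empirical_measure_def
      by (subst AE_distr_iff[OF measurable_nth_uniform_count])
        (auto simp: finite_imp_closed space_uniform_count_measure)
    show "0 \<le> bregman_code \<Omega> \<phi> x c" if "x \<in> set zs" for x
      using assms that by (intro bregman_code_nonneg) auto
    show "continuous_on (set zs) (\<lambda>x. bregman_code \<Omega> \<phi> x c)"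
      using continuous_on_subset[OF continuous_on_bregman_code[OF differentiable_imp_continuous_on]]
        assms(2,4,5) by blast
  qed (use assms in \<open>auto simp: empirical_measure_def finite_imp_closed\<close>)
qed

lemma excess_empirical_measure:
  assumes "carried_code (empirical_measure zs) (set zs) \<Omega> \<phi> c"
  shows "excess (set zs) \<Omega> \<phi> (empirical_measure zs) c t =
    sum_list (map (\<lambda>x. max 0 (t - bregman_code \<Omega> \<phi> x c)) zs) / length zs"
proof -
  interpret carried_code "empirical_measure zs" "set zs" \<Omega> \<phi> c by fact
  have m: "(\<lambda>x. max 0 (t - cost x)) \<in> borel_measurable borel"
    using measurable_cost by (intro borel_measurable_max borel_measurable_diff) auto
  have "map (\<lambda>x. max 0 (t - cost x)) zs = map (\<lambda>x. max 0 (t - bregman_code \<Omega> \<phi> x c)) zs"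
    by (simp add: cost_on_def)
  then show ?thesis
    unfolding excess_def by (simp only: integral_empirical_measure[OF m])
qed

text \<open>Weak duality at \<open>t\<close>: an adversarial point adds at most \<open>t\<close> to
  the excess since divergences are nonnegative, and a clean point \<open>x\<close> adds at most
  \<open>v x\<close>.\<close>

lemma trimmed_distortion_contaminated_ge:
  fixes zs ys :: "'a::euclidean_space list" and h t :: real and v w :: "'a \<Rightarrow> real"
  assumes carried: "carried_code (empirical_measure (zs @ ys)) (set (zs @ ys)) \<Omega> \<phi> c"
    and h: "0 < h" "h < 1" and t: "0 \<le> t"
    and v: "\<And>x. x \<in> set zs \<Longrightarrow> max 0 (t - bregman_code \<Omega> \<phi> x c) \<le> v x"
  shows "ennreal (h * t - (sum_list (map v zs) + length ys * t) / length (zs @ ys))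
    \<le> trimmed_distortion \<Omega> \<phi> (empirical_measure (zs @ ys)) h c"
proof -
  interpret carried_code "empirical_measure (zs @ ys)" "set (zs @ ys)" \<Omega> \<phi> c by fact
  let ?g = "\<lambda>x. max 0 (t - bregman_code \<Omega> \<phi> x c)"
  have "sum_list (map ?g zs) \<le> sum_list (map v zs)" using v by (rule sum_list_mono)
  moreover have "sum_list (map ?g ys) \<le> sum_list (map (\<lambda>_. t) ys)"
    using nonneg t by (intro sum_list_mono) simp
  moreover have "sum_list (map (\<lambda>_. t) ys) = length ys * t" by (simp add: sum_list_triv)
  ultimately have "sum_list (map ?g (zs @ ys)) \<le> sum_list (map v zs) + length ys * t" by simp
  then have "excess (set (zs @ ys)) \<Omega> \<phi> (empirical_measure (zs @ ys)) c t
      \<le> (sum_list (map v zs) + length ys * t) / length (zs @ ys)"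
    unfolding excess_empirical_measure[OF carried] by (rule divide_right_mono) simp
  then have "ennreal (h * t - (sum_list (map v zs) + length ys * t) / length (zs @ ys))
      \<le> ennreal (h * t - excess (set (zs @ ys)) \<Omega> \<phi> (empirical_measure (zs @ ys)) c t)"
    by (intro ennreal_leI) simp
  also have "\<dots> \<le> trimmed_distortion \<Omega> \<phi> (empirical_measure (zs @ ys)) h c"
    using h t by (intro trimmed_distortion_ge) auto
  finally show ?thesis .
qed

text \<open>Keeps clean points only, with enough total weight. With \<open>t\<close> optimal in the
  dual formula, the bound follows from \<open>w x * (t - d) \<le> max 0 (t - d)\<close>, where
  \<open>d\<close> is the divergence of \<open>x\<close> from the codebook.\<close>

lemma trimmed_distortion_contaminated_le:
  fixes zs ys :: "'a::euclidean_space list" and h t :: real and v w :: "'a \<Rightarrow> real"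
  assumes carried: "carried_code (empirical_measure (zs @ ys)) (set (zs @ ys)) \<Omega> \<phi> c"
    and h: "0 < h" "h < 1" and zs: "zs \<noteq> []"
    and w: "\<And>x. 0 \<le> w x" "\<And>x. w x \<le> 1" "h * length (zs @ ys) \<le> sum_list (map w zs)"
  shows "trimmed_distortion \<Omega> \<phi> (empirical_measure (zs @ ys)) h c
    \<le> ennreal (sum_list (map (\<lambda>x. w x * bregman_code \<Omega> \<phi> x c) zs) / length (zs @ ys))"
proof -
  interpret carried_code "empirical_measure (zs @ ys)" "set (zs @ ys)" \<Omega> \<phi> c by fact
  obtain t where t: "0 \<le> t" "trimmed_distortion \<Omega> \<phi> (empirical_measure (zs @ ys)) h c =
      ennreal (h * t - excess (set (zs @ ys)) \<Omega> \<phi> (empirical_measure (zs @ ys)) c t)"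
    by (rule trimmed_distortion_eq[OF h])
  let ?f = "\<lambda>x. bregman_code \<Omega> \<phi> x c"
  let ?g = "\<lambda>x. max 0 (t - ?f x)"
  let ?N = "real (length (zs @ ys))"
  have N: "0 < ?N" using zs by (cases zs) auto
  have "w x * (t - ?f x) \<le> ?g x" for x
  proof -
    have "w x * (t - ?f x) \<le> w x * ?g x" using w(1) by (intro mult_left_mono) auto
    also have "\<dots> \<le> 1 * ?g x" using w(2) by (intro mult_right_mono) auto
    finally show ?thesis by simp
  qed
  then have "sum_list (map (\<lambda>x. w x * (t - ?f x)) zs) \<le> sum_list (map ?g zs)"
    by (intro sum_list_mono)
  moreover have "sum_list (map (\<lambda>x. w x * (t - ?f x)) zs) =
      sum_list (map w zs) * t - sum_list (map (\<lambda>x. w x * ?f x) zs)"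
    by (induction zs) (simp_all add: algebra_simps)
  moreover have "0 \<le> sum_list (map ?g ys)" by (intro sum_list_nonneg) auto
  moreover have "h * ?N * t \<le> sum_list (map w zs) * t" using w(3) t(1) by (rule mult_right_mono)
  ultimately have "h * ?N * t - sum_list (map ?g (zs @ ys)) \<le> sum_list (map (\<lambda>x. w x * ?f x) zs)"
    by simp
  then have "(h * ?N * t - sum_list (map ?g (zs @ ys))) / ?N \<le> sum_list (map (\<lambda>x. w x * ?f x) zs) / ?N"
    by (rule divide_right_mono) simp
  then have "h * t - sum_list (map ?g (zs @ ys)) / ?N \<le> sum_list (map (\<lambda>x. w x * ?f x) zs) / ?N"
    using N by (simp add: diff_divide_distrib)
  then show ?thesis
    unfolding t(2) excess_empirical_measure[OF carried] by (rule ennreal_leI)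
qed

text \<open>Finiteness of \<open>a\<close> is essential: in \<open>ereal\<close> the difference of
  two positive infinities is infinite.\<close>

lemma ennreal_less_of_diff_pos:
  assumes "0 < enn2ereal a - enn2ereal d" "a \<noteq> \<top>"
  shows "d < a"
proof (cases a)
  case (real x)
  show ?thesis
  proof (cases d)
    case (real y)
    then show ?thesis
      using assms \<open>a = ennreal x\<close> \<open>0 \<le> x\<close> by (simp add: enn2ereal_ennreal ennreal_less_iff)
  next
    case top
    then show ?thesis using assms \<open>a = ennreal x\<close> \<open>0 \<le> x\<close> by (simp add: enn2ereal_ennreal)
  qed
qed (use assms in simp)

lemma (in prob_space) small_tail:
  fixes f :: "'a \<Rightarrow> real"
  assumes [measurable]: "f \<in> borel_measurable M" and "0 < e"
  obtains C where "prob {x \<in> space M. C < f x} < e"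
proof -
  let ?A = "\<lambda>i. {x \<in> space M. real i < f x}"
  have "(\<lambda>i. prob (?A i)) \<longlonglongrightarrow> prob (\<Inter>i. ?A i)"
    by (rule finite_Lim_measure_decseq) (auto simp: decseq_def)
  moreover have "(\<Inter>i. ?A i) = {}"
  proof (rule equals0I)
    fix x assume "x \<in> (\<Inter>i. ?A i)"
    then have "real i < f x" for i by blast
    moreover obtain i where "f x < real i" using reals_Archimedean2 by blast
    ultimately show False by (meson less_asym)
  qed
  ultimately have "(\<lambda>i. prob (?A i)) \<longlonglongrightarrow> 0" by simp
  then have "\<forall>\<^sub>F i in sequentially. prob (?A i) < e" using \<open>0 < e\<close> by (rule order_tendstoD)
  then obtain i where "prob (?A i) < e" by (auto simp: eventually_sequentially)
  then show thesis using that by blast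
qed

section \<open>Robustness of optimal codebooks\<close>

text \<open>Deleting one centre splits the minimum; \<open>0 < k\<close> leaves a nonempty list, for
  which \<open>Min\<close> is meaningful.\<close>

lemma bregman_code_remove_far:
  assumes "length c = Suc k" "0 < k" "j < Suc k"
  obtains c' where "length c' = k" "set c' \<subseteq> set c"
    "\<And>x. bregman_code \<Omega> \<phi> x c = min (bregman \<Omega> \<phi> x (c ! j)) (bregman_code \<Omega> \<phi> x c')"
proof -
  define c' where "c' = take j c @ drop (Suc j) c"
  have len: "length c' = k" using assms by (simp add: c'_def)
  have "set c = set (take j c @ c ! j # drop (Suc j) c)"
    using assms id_take_nth_drop[of j c] by simp
  then have set: "set c = insert (c ! j) (set c')" by (simp add: c'_def)
  moreover have "set c' \<noteq> {}" using len assms by auto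
  ultimately have "bregman_code \<Omega> \<phi> x c = min (bregman \<Omega> \<phi> x (c ! j)) (bregman_code \<Omega> \<phi> x c')" for x
    by (simp add: bregman_code_def)
  then show thesis using that len set by blast
qed

theorem theorem15:
  fixes \<Omega> :: "'a::euclidean_space set" and \<phi> :: "'a \<Rightarrow> real" and P :: "'a measure"
    and h b p :: real and k :: nat
  assumes "0 < h" and "h < 1" and "2 \<le> k"
    and "convex \<Omega>" and "strictly_convex_on \<Omega> \<phi>" and "C2_on \<Omega> \<phi>"
    and "prob_space P" and "sets P = sets borel"
    and "closure (convex hull (measure_support P)) \<subseteq> interior \<Omega>"
    and "2 \<le> p" and "integrable P (\<lambda>u. norm u powr p)"
    and "0 < opt_distortion \<Omega> \<phi> P (k - 1) h - opt_distortion \<Omega> \<phi> P k h"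
    and "0 \<le> b" and "ereal b < discernability_factor \<Omega> \<phi> P k h"
  shows "\<exists>C K :: real. \<forall>\<^sub>F n in sequentially.
    \<forall>(M :: 'w measure) (X :: nat \<Rightarrow> 'w \<Rightarrow> 'a).
      prob_space M \<longrightarrow>
      prob_space.indep_vars M (\<lambda>_. borel) X {..<n} \<longrightarrow>
      (\<forall>i<n. distr M borel (X i) = P) \<longrightarrow>
      (\<exists>E\<in>sets M. measure M E > 1 - real n powr (- p / 2) \<and>
        (\<forall>\<omega>\<in>E. \<forall>s::nat. real s / real (n + s) \<le> b \<longrightarrow>
          (\<forall>xs :: 'a list. length xs = s \<longrightarrow> set xs \<subseteq> \<Omega> \<longrightarrow>
            (\<forall>c. is_arg_min
                   (trimmed_distortion \<Omega> \<phi> (empirical_measure (map (\<lambda>i. X i \<omega>) [0..<n] @ xs)) h)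
                   (\<lambda>c. c \<in> codebooks \<Omega> k) c \<longrightarrow>
               Max ((\<lambda>j. bregman_set \<Omega> \<phi> (cball 0 C) (c ! j)) ` {..<k}) \<le> ereal K))))"
proof -
  note h = assms(1,2) and conv = assms(5) and sets_P = assms(8)
  interpret P: prob_space P by fact
  have space_P: "space P = UNIV" using sets_eq_imp_space_eq[OF sets_P] by simp
  have diff: "\<phi> differentiable_on \<Omega>" using assms(6) by (simp add: C2_on_def)
  then have cont: "continuous_on \<Omega> \<phi>" by (rule differentiable_imp_continuous_on)
  have k: "0 < k - 1" "Suc (k - 1) = k" using assms(3) by auto
  define F where "F = closure (convex hull (measure_support P))"
  have F: "closed F" "F \<subseteq> interior \<Omega>" "F \<subseteq> \<Omega>"
    using assms(9) interior_subset[of \<Omega>] by (auto simp: F_def)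
  have "measure_support P \<subseteq> F" unfolding F_def using closure_subset hull_subset by (metis order_trans)
  then have AE_F: "AE x in P. x \<in> F"
    using AE_measure_support[OF sets_P] by (auto elim: eventually_mono)
  have carried: "carried_code P F \<Omega> \<phi> c" if "c \<in> codebooks \<Omega> j" "0 < j" for c j
  proof unfold_locales
    have c: "c \<noteq> []" "set c \<subseteq> \<Omega>" using that by (auto simp: codebooks_def)
    show "continuous_on F (\<lambda>x. bregman_code \<Omega> \<phi> x c)"
      using continuous_on_bregman_code[OF cont c(1)] F(3) by (rule continuous_on_subset)
    show "0 \<le> bregman_code \<Omega> \<phi> x c" if "x \<in> F" for x
      using bregman_code_nonneg[OF conv diff c] F(3) that by blast
  qed (use F AE_F sets_P in auto)
  have "F \<noteq> {}" using AE_F P.AE_False by auto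
  then obtain x0 where "x0 \<in> \<Omega>" using F(3) by blast
  \<comment> \<open>A constant codebook shows that \<open>k - 1\<close> point codebooks exist and,
    later, that their optimum is finite.\<close>
  then have c0: "replicate (k - 1) x0 \<in> codebooks \<Omega> (k - 1)" by (auto simp: codebooks_def)

  \<comment> \<open>Levels between \<open>b\<close> and the discernability factor\<close>
  obtain b' where b': "b < b'" "b' \<le> h" "b' \<le> 1 - h"
    "0 < Min ((\<lambda>j. opt_distortion \<Omega> \<phi> P (j - 1) ((h - b') / (1 - b'))
                    - opt_distortion \<Omega> \<phi> P j (h / (1 - b'))) ` {2..k})"
    using assms(14) unfolding discernability_factor_def by (auto simp: less_Sup_iff)
  have b: "0 \<le> b" "b < 1" "b' < 1" using assms(13) b' h by auto
  \<comment> \<open>\<open>h1\<close> and \<open>H1\<close> are the lower levels at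
    \<open>b'\<close> and \<open>b\<close>; their gap pays for truncation and for points outside a
    ball. The upper level is taken at the midpoint: \<open>h2 > h / (1 - b)\<close> leaves room for
    sampling fluctuations, and \<open>h2 < 1\<close> holds even if
    \<open>h / (1 - b') = 1\<close>.\<close>
  define h1 where "h1 = (h - b') / (1 - b')"
  define H1 where "H1 = (h - b) / (1 - b)"
  define h2 where "h2 = h / (1 - (b + b') / 2)"
  have "0 < opt_distortion \<Omega> \<phi> P (k - 1) h1 - opt_distortion \<Omega> \<phi> P k (h / (1 - b'))"
    using b'(4) assms(3) by (auto simp: h1_def)
  then have gap: "0 < enn2ereal (INF c\<in>codebooks \<Omega> (k - 1). trimmed_distortion \<Omega> \<phi> P h1 c)
      - enn2ereal (INF c\<in>codebooks \<Omega> k. trimmed_distortion \<Omega> \<phi> P (h / (1 - b')) c)"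
    (is "0 < enn2ereal ?a - enn2ereal ?d")
    by (simp add: opt_distortion_def)
  have h1: "0 < h1" "h1 < 1" "h1 < H1"
  proof -
    have "0 \<le> h1" using b' b by (simp add: h1_def)
    \<comment> \<open>At level 0 the distortion is 0 by definition, which rules out a positive
      gap.\<close>
    moreover have "h1 \<noteq> 0"
    proof
      assume "h1 = 0"
      have "?a \<le> trimmed_distortion \<Omega> \<phi> P h1 (replicate (k - 1) x0)" using c0 by (rule INF_lower)
      also have "\<dots> = 0" using \<open>h1 = 0\<close> by (simp add: trimmed_distortion_def)
      finally have "?a = 0" by simp
      then have "\<not> 0 < enn2ereal ?a - enn2ereal ?d" by (simp add: zero_ennreal.rep_eq not_less)
      then show False using gap by simp
    qed
    ultimately show "0 < h1" by simp
    show "h1 < 1" using b h by (simp add: h1_def divide_less_eq)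
    have "0 < (b' - b) * (1 - h)" using b'(1) h by simp
    then show "h1 < H1" using b by (simp add: h1_def H1_def field_simps)
  qed
  have h2: "0 < h2" "h2 < 1" "h / (1 - b) < h2" "h2 \<le> h / (1 - b')" "h / (1 - b') \<le> 1"
    using b b' h by (auto simp: h2_def field_simps)
  have "?a \<noteq> \<top>"
  proof -
    interpret c0: carried_code P F \<Omega> \<phi> "replicate (k - 1) x0" using c0 k(1) by (rule carried)
    obtain t where "trimmed_distortion \<Omega> \<phi> P h1 (replicate (k - 1) x0) =
        ennreal (h1 * t - excess F \<Omega> \<phi> P (replicate (k - 1) x0) t)"
      using h1 by (elim c0.trimmed_distortion_eq)
    then have "?a \<le> ennreal (h1 * t - excess F \<Omega> \<phi> P (replicate (k - 1) x0) t)"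
      using c0 by (metis INF_lower)
    then show ?thesis using neq_top_trans ennreal_neq_top by blast
  qed
  then obtain R where R: "0 \<le> R" "?a = ennreal R" by (cases ?a) auto
  have "?d < ?a" using gap \<open>?a \<noteq> \<top>\<close> by (rule ennreal_less_of_diff_pos)
  \<comment> \<open>A fixed codebook that, even at level \<open>h / (1 - b')\<close>, beats every
    \<open>k - 1\<close> point codebook at level \<open>h1\<close>.\<close>
  then obtain c1 where c1: "c1 \<in> codebooks \<Omega> k" "trimmed_distortion \<Omega> \<phi> P (h / (1 - b')) c1 < ennreal R"
    unfolding R(2) by (auto simp: INF_less_iff)
  have R_le: "ennreal R \<le> trimmed_distortion \<Omega> \<phi> P h1 c" if "c \<in> codebooks \<Omega> (k - 1)" for c
    unfolding R(2)[symmetric] using that by (rule INF_lower)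

  \<comment> \<open>Trimming weight of the reference codebook\<close>
  interpret c1: carried_code P F \<Omega> \<phi> c1 using c1(1) assms(3) by (intro carried) auto
  obtain t1 w where t1: "0 \<le> t1" and w: "w \<in> borel_measurable borel" "\<And>x. 0 \<le> w x" "\<And>x. w x \<le> 1"
    "P.expectation w = h2" "P.expectation (\<lambda>x. w x * c1.cost x) = h2 * t1 - excess F \<Omega> \<phi> P c1 t1"
    "\<And>x. w x * c1.cost x \<le> t1"
    using c1.weighted_cost[OF h2(1,2)] by blast
  define A where "A = h2 * t1 - excess F \<Omega> \<phi> P c1 t1"
  have "0 \<le> A"
    unfolding A_def w(5)[symmetric] using w(2) by (intro Bochner_Integration.integral_nonneg) simp
  \<comment> \<open>The dual expression increases with the level; raising \<open>h2\<close> to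
    \<open>h / (1 - b')\<close> makes the bound on \<open>c1\<close> applicable.\<close>
  have "A \<le> h / (1 - b') * t1 - excess F \<Omega> \<phi> P c1 t1"
    unfolding A_def using mult_right_mono[OF h2(4) t1] by simp
  then have "ennreal A \<le> ennreal (h / (1 - b') * t1 - excess F \<Omega> \<phi> P c1 t1)" by (rule ennreal_leI)
  also have "\<dots> \<le> trimmed_distortion \<Omega> \<phi> P (h / (1 - b')) c1"
    using h2 h b t1 by (intro c1.trimmed_distortion_ge) auto
  also have "\<dots> < ennreal R" by (rule c1(2))
  finally have "A < R" using \<open>0 \<le> A\<close> by (simp add: ennreal_less_iff)
  \<comment> \<open>Four tolerances fill the gap: one for the upper bound, two for the lower bound,
    and one left for strictness.\<close>
  define e where "e = (R - A) / 4"
  have e: "0 < e" "R = A + 4 * e" using \<open>A < R\<close> by (simp_all add: e_def field_simps)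

  \<comment> \<open>Truncation height, ball and finite net\<close>
  define T where "T = 2 * R / (H1 - h1)"
  have T: "0 \<le> T" using R h1 by (simp add: T_def)
  \<comment> \<open>Raising the level from \<open>(H1 + h1) / 2\<close> to \<open>H1\<close> gains
    \<open>2 * \<delta>\<close>: one \<delta> for the mass outside the ball, one for its empirical
    deviation.\<close>
  define \<delta> where "\<delta> = (H1 - h1) / 4"
  have \<delta>: "0 < \<delta>" using h1 by (simp add: \<delta>_def)
  have "norm \<in> borel_measurable P" by (simp add: measurable_cong_sets[OF sets_P refl])
  then obtain C where C: "P.prob {x. C < norm x} < \<delta>"
    using P.small_tail[OF _ \<delta>, of norm] by (auto simp: space_P)
  have comp: "compact (F \<inter> cball 0 C)" "F \<inter> cball 0 C \<subseteq> interior \<Omega>" using F by auto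
  obtain N where N: "finite N" "N \<subseteq> codebooks \<Omega> (k - 1)"
    "\<And>c. c \<in> codebooks \<Omega> (k - 1) \<Longrightarrow> \<exists>c'\<in>N. \<forall>x\<in>F \<inter> cball 0 C.
        \<bar>min (bregman_code \<Omega> \<phi> x c) T - min (bregman_code \<Omega> \<phi> x c') T\<bar> \<le> e"
    using bregman_code_truncated_net[OF cont bregman_nonneg[OF conv diff] comp e(1) k(1), of T] by blast
  \<comment> \<open>The dual level is fixed in advance for each net codebook, so only one function
    per net codebook has to concentrate.\<close>
  have "\<exists>t. 0 \<le> t \<and> t \<le> T \<and> R \<le> (H1 + h1) / 2 * t - excess F \<Omega> \<phi> P c t" if "c \<in> N" for c
  proof -
    interpret c: carried_code P F \<Omega> \<phi> c using that N(2) k(1) by (intro carried) auto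
    show ?thesis
      using c.truncated_level[OF h1(1,3,2) R(1) R_le] that N(2) unfolding T_def by blast
  qed
  then obtain \<tau> where \<tau>: "\<And>c. c \<in> N \<Longrightarrow> 0 \<le> \<tau> c" "\<And>c. c \<in> N \<Longrightarrow> \<tau> c \<le> T"
    "\<And>c. c \<in> N \<Longrightarrow> R \<le> (H1 + h1) / 2 * \<tau> c - excess F \<Omega> \<phi> P c (\<tau> c)"
    by metis

  \<comment> \<open>Finite class of test functions\<close>
  define far where "far = (indicator {x. C < norm x} :: 'a \<Rightarrow> real)"
  define gain where "gain c x = max 0 (\<tau> c - cost_on F \<Omega> \<phi> c x)" for c x
  \<comment> \<open>Concentration bounds empirical means from above only; \<open>- w\<close> enters
    because the total weight of the clean points is needed from below.\<close>
  define G where "G = {far, \<lambda>x. - w x, \<lambda>x. w x * c1.cost x} \<union> gain ` N"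
  \<comment> \<open>Here \<open>e\<close> serves the weighted cost and the gains, \<delta> serves
    \<open>far\<close>, and the last entry serves the total weight.\<close>
  define e' where "e' = min e (min \<delta> (h2 - h / (1 - b)))"
  have e': "0 < e'" "e' \<le> e" "e' \<le> \<delta>" "e' \<le> h2 - h / (1 - b)"
    using e \<delta> h2 by (auto simp: e'_def)
  have G_meas: "g \<in> borel_measurable borel" if "g \<in> G" for g
  proof -
    have "gain c \<in> borel_measurable borel" if "c \<in> N" for c
    proof -
      interpret c: carried_code P F \<Omega> \<phi> c using that N(2) k(1) by (intro carried) auto
      show ?thesis unfolding gain_def using c.measurable_cost by measurable
    qed
    moreover have "far \<in> borel_measurable borel" unfolding far_def by measurable
    ultimately show ?thesis using that w(1) c1.measurable_cost by (auto simp: G_def)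
  qed
  have G_bd: "\<bar>g x\<bar> \<le> 1 + t1 + T" if "g \<in> G" for g x
  proof -
    have "\<bar>far x\<bar> \<le> 1 + t1 + T" using t1 T by (simp add: far_def indicator_def)
    moreover have "\<bar>- w x\<bar> \<le> 1 + t1 + T" using w(2,3)[of x] t1 T by simp
    moreover have "\<bar>w x * c1.cost x\<bar> \<le> 1 + t1 + T" using w(2,6)[of x] t1 T by (simp add: abs_mult)
    moreover have "\<bar>gain c x\<bar> \<le> 1 + t1 + T" if "c \<in> N" for c
    proof -
      interpret c: carried_code P F \<Omega> \<phi> c using that N(2) k(1) by (intro carried) auto
      show ?thesis using c.cost_nonneg[of x] \<tau>(1,2)[OF that] t1 unfolding gain_def by linarith
    qed
    ultimately show ?thesis using that by (auto simp: G_def)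
  qed

  \<comment> \<open>Deterministic comparison on a good sample\<close>
  have robust: "Max ((\<lambda>j. bregman_set \<Omega> \<phi> (cball 0 C) (c ! j)) ` {..<k}) \<le> ereal T"
    if x: "\<And>i. i < n \<Longrightarrow> x i \<in> F" and n: "0 < n"
      and conc: "\<And>g. g \<in> G \<Longrightarrow> (\<Sum>i<n. g (x i)) / n < P.expectation g + e'"
      and s: "real (length xs) / real (n + length xs) \<le> b" and xs: "set xs \<subseteq> \<Omega>"
      and min: "is_arg_min (trimmed_distortion \<Omega> \<phi> (empirical_measure (map x [0..<n] @ xs)) h)
        (\<lambda>c. c \<in> codebooks \<Omega> k) c"
    for x :: "nat \<Rightarrow> 'a" and n and xs c
  proof (rule ccontr)
    define zs where "zs = map x [0..<n]"
    define L where "L = real (length (zs @ xs))"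
    have L: "L = real n + length xs" "0 < L" using n by (simp_all add: L_def zs_def)
    have zs: "zs \<noteq> []" "set zs \<subseteq> F" using x n by (auto simp: zs_def)
    have sum_zs: "sum_list (map g zs) = (\<Sum>i<n. g (x i))" for g :: "'a \<Rightarrow> real"
      by (simp add: zs_def o_def interv_sum_list_conv_sum_set_nat atLeast0LessThan)
    have mean: "sum_list (map g zs) \<le> n * (P.expectation g + e')" if "g \<in> G" for g
      using conc[OF that] n unfolding sum_zs by (simp add: field_simps)
    have emp: "carried_code (empirical_measure (zs @ xs)) (set (zs @ xs)) \<Omega> \<phi> c"
      if "c \<in> codebooks \<Omega> k" for c
      using that zs xs F(3) assms(3)
      by (intro carried_code_empirical_measure conv diff) (auto simp: codebooks_def)
    have c: "c \<in> codebooks \<Omega> k" using min by (simp add: is_arg_min_def)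
    have nL: "(1 - b) * L \<le> n" using s n L by (simp add: field_simps)

    \<comment> \<open>The weights of \<open>c1\<close> trim all adversarial points; enough clean
      weight is left because \<open>h2 - e'\<close> is at least \<open>h / (1 - b)\<close>.\<close>
    have upper: "trimmed_distortion \<Omega> \<phi> (empirical_measure (zs @ xs)) h c1 \<le> ennreal (n * (A + e) / L)"
    proof -
      have "- sum_list (map w zs) \<le> n * (P.expectation (\<lambda>x. - w x) + e')"
        using mean[of "\<lambda>x. - w x"] by (simp add: G_def sum_zs sum_negf)
      then have "n * (h2 - e') \<le> sum_list (map w zs)" using w(4) by (simp add: algebra_simps)
      moreover have "n * (h / (1 - b)) \<le> n * (h2 - e')" using e'(4) by (intro mult_left_mono) auto
      moreover have "h * L \<le> n * (h / (1 - b))"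
        using mult_left_mono[OF nL, of h] h b by (simp add: field_simps)
      ultimately have "h * L \<le> sum_list (map w zs)" by linarith
      then have "trimmed_distortion \<Omega> \<phi> (empirical_measure (zs @ xs)) h c1
          \<le> ennreal (sum_list (map (\<lambda>x. w x * bregman_code \<Omega> \<phi> x c1) zs) / L)"
        unfolding L_def using w(2,3) zs(1) h
        by (intro trimmed_distortion_contaminated_le emp c1(1)) auto
      also have "map (\<lambda>x. w x * bregman_code \<Omega> \<phi> x c1) zs = map (\<lambda>x. w x * c1.cost x) zs"
        using zs(2) by (auto simp: cost_on_def)
      also have "ennreal (sum_list (map (\<lambda>x. w x * c1.cost x) zs) / L) \<le> ennreal (n * (A + e) / L)"
      proof (intro ennreal_leI divide_right_mono)
        have "sum_list (map (\<lambda>x. w x * c1.cost x) zs) \<le> n * (A + e')"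
          using mean[of "\<lambda>x. w x * c1.cost x"] w(5) by (simp add: G_def A_def)
        also have "\<dots> \<le> n * (A + e)" using e'(2) by (intro mult_left_mono) auto
        finally show "sum_list (map (\<lambda>x. w x * c1.cost x) zs) \<le> n * (A + e)" .
      qed (use L in simp)
      finally show ?thesis .
    qed

    assume "\<not> Max ((\<lambda>j. bregman_set \<Omega> \<phi> (cball 0 C) (c ! j)) ` {..<k}) \<le> ereal T"
    then obtain j where j: "j < k" "ereal T < bregman_set \<Omega> \<phi> (cball 0 C) (c ! j)"
      using assms(3) by (subst (asm) Max_le_iff) (auto simp: not_le lessThan_empty_iff)
    \<comment> \<open>On the ball the centre \<open>c ! j\<close> never brings the cost down to
      \<open>T\<close>, so dropping it does not alter costs truncated at \<open>T\<close>.\<close>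
    have far_j: "T < bregman \<Omega> \<phi> y (c ! j)" if "y \<in> F \<inter> cball 0 C" for y
    proof -
      have "bregman_set \<Omega> \<phi> (cball 0 C) (c ! j) \<le> ereal (bregman \<Omega> \<phi> y (c ! j))"
        unfolding bregman_set_def using that F(3) by (intro INF_lower) auto
      with j(2) show ?thesis by (metis less_le_trans ereal_less_eq(3) not_le)
    qed
    obtain c' where c': "length c' = k - 1" "set c' \<subseteq> set c"
      "\<And>x. bregman_code \<Omega> \<phi> x c = min (bregman \<Omega> \<phi> x (c ! j)) (bregman_code \<Omega> \<phi> x c')"
      using bregman_code_remove_far[of c "k - 1" j] c k j(1) by (auto simp: codebooks_def)
    then have "c' \<in> codebooks \<Omega> (k - 1)" using c by (auto simp: codebooks_def)
    then obtain c2 where c2: "c2 \<in> N" "\<And>x. x \<in> F \<inter> cball 0 C \<Longrightarrow>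
        \<bar>min (bregman_code \<Omega> \<phi> x c') T - min (bregman_code \<Omega> \<phi> x c2) T\<bar> \<le> e"
      using N(3) by blast
    note \<tau>' = \<tau>[OF c2(1)]
    \<comment> \<open>Majorises the clean excess terms by test functions: on the ball,
      \<open>c2\<close> replaces \<open>c\<close> at the price \<open>e\<close>, since
      \<open>\<tau> c2 \<le> T\<close>; off the ball a term is at most
      \<open>\<tau> c2\<close>.\<close>
    define v where "v y = \<tau> c2 * far y + gain c2 y + e" for y
    have v: "max 0 (\<tau> c2 - bregman_code \<Omega> \<phi> y c) \<le> v y" if "y \<in> set zs" for y
    proof (cases "norm y \<le> C")
      case True
      then have y: "y \<in> F \<inter> cball 0 C" using zs(2) that by auto
      have "v y = gain c2 y + e" using True by (simp add: v_def far_def)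
      moreover have "gain c2 y = max 0 (\<tau> c2 - bregman_code \<Omega> \<phi> y c2)"
        using y by (simp add: gain_def cost_on_def)
      ultimately show ?thesis
        using far_j[OF y] c2(2)[OF y] \<tau>'(1,2) e(1) unfolding c'(3)[of y] by linarith
    next
      case False
      have "c \<noteq> []" "set c \<subseteq> \<Omega>" "y \<in> \<Omega>"
        using c assms(3) zs(2) F(3) that by (auto simp: codebooks_def)
      then have "0 \<le> bregman_code \<Omega> \<phi> y c" by (rule bregman_code_nonneg[OF conv diff])
      moreover have "far y = 1" using False by (simp add: far_def)
      moreover have "0 \<le> gain c2 y" by (simp add: gain_def)
      ultimately show ?thesis using \<tau>'(1) e(1) unfolding v_def by simp
    qed
    have lower: "ennreal (n * (R - 2 * e) / L) \<le> trimmed_distortion \<Omega> \<phi> (empirical_measure (zs @ xs)) h c"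
    proof -
      have "P.expectation far = P.prob {x. C < norm x}"
        unfolding far_def by (simp add: space_P)
      then have "sum_list (map far zs) \<le> n * (P.prob {x. C < norm x} + e')"
        using mean[of far] by (simp add: G_def)
      also have "\<dots> \<le> n * (2 * \<delta>)" using C e'(3) by (intro mult_left_mono) auto
      finally have 1: "\<tau> c2 * sum_list (map far zs) \<le> \<tau> c2 * (n * (2 * \<delta>))"
        using \<tau>'(1) by (rule mult_left_mono)
      have "P.expectation (gain c2) = excess F \<Omega> \<phi> P c2 (\<tau> c2)"
        by (simp add: excess_def gain_def[abs_def])
      then have "sum_list (map (gain c2) zs) \<le> n * (excess F \<Omega> \<phi> P c2 (\<tau> c2) + e')"
        using mean[of "gain c2"] c2(1) by (simp add: G_def)
      also have "\<dots> \<le> n * ((H1 + h1) / 2 * \<tau> c2 - R + e)"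
        using \<tau>'(3) e'(2) by (intro mult_left_mono) auto
      finally have 2: "sum_list (map (gain c2) zs) \<le> n * ((H1 + h1) / 2 * \<tau> c2 - R + e)" .
      have 3: "sum_list (map v zs) = \<tau> c2 * sum_list (map far zs) + sum_list (map (gain c2) zs) + n * e"
        by (simp add: v_def sum_zs sum.distrib sum_distrib_left)
      \<comment> \<open>Even if all adversarial points are kept, the clean ones must supply level
        \<open>H1\<close>. After multiplication by \<open>1 - b\<close> the two sides differ by
        \<open>1 - h\<close> times \<open>b * L - length xs\<close>, which is nonnegative.\<close>
      have "n * H1 \<le> h * L - length xs"
      proof -
        have "(1 - b) * (h * L - length xs) - n * (h - b) = (1 - h) * (b * L - length xs)"
          unfolding L(1) by (simp add: algebra_simps)
        moreover have "0 \<le> (1 - h) * (b * L - length xs)"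
          using nL h unfolding L(1) by (intro mult_nonneg_nonneg) (auto simp: algebra_simps)
        ultimately show ?thesis using b by (simp add: H1_def field_simps)
      qed
      then have "n * H1 * \<tau> c2 \<le> (h * L - length xs) * \<tau> c2" using \<tau>'(1) by (rule mult_right_mono)
      \<comment> \<open>By the choice of \<delta>,
        \<open>(H1 + h1) / 2 + 2 * \<delta> = H1\<close>.\<close>
      moreover have "\<tau> c2 * (n * (2 * \<delta>)) + n * ((H1 + h1) / 2 * \<tau> c2) = n * H1 * \<tau> c2"
        by (simp add: \<delta>_def field_simps)
      ultimately have "n * (R - 2 * e) \<le> h * \<tau> c2 * L - (sum_list (map v zs) + length xs * \<tau> c2)"
        using 1 2 unfolding 3 by (simp add: algebra_simps)
      then have "n * (R - 2 * e) / L \<le> (h * \<tau> c2 * L - (sum_list (map v zs) + length xs * \<tau> c2)) / L"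
        using L(2) by (intro divide_right_mono) auto
      then have "n * (R - 2 * e) / L \<le> h * \<tau> c2 - (sum_list (map v zs) + length xs * \<tau> c2) / L"
        using L(2) by (simp add: diff_divide_distrib)
      then have "ennreal (n * (R - 2 * e) / L)
          \<le> ennreal (h * \<tau> c2 - (sum_list (map v zs) + length xs * \<tau> c2) / L)"
        by (rule ennreal_leI)
      also have "\<dots> \<le> trimmed_distortion \<Omega> \<phi> (empirical_measure (zs @ xs)) h c"
        unfolding L_def using h \<tau>'(1) v by (intro trimmed_distortion_contaminated_ge emp c) auto
      finally show ?thesis .
    qed
    \<comment> \<open>Here \<open>R - 2 * e = A + 2 * e\<close>, so \<open>c1\<close> is strictly
      better than the supposed minimiser.\<close>
    have "n * (A + e) / L < n * (R - 2 * e) / L"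
      using n L(2) e by (intro divide_strict_right_mono mult_strict_left_mono) auto
    moreover have "0 \<le> n * (A + e) / L" using \<open>0 \<le> A\<close> e(1) L(2) by simp
    ultimately have "ennreal (n * (A + e) / L) < ennreal (n * (R - 2 * e) / L)"
      by (simp only: ennreal_less_iff)
    then have "trimmed_distortion \<Omega> \<phi> (empirical_measure (zs @ xs)) h c1
        < trimmed_distortion \<Omega> \<phi> (empirical_measure (zs @ xs)) h c"
      using upper lower by (meson le_less_trans less_le_trans)
    then show False using min c1(1) by (auto simp: is_arg_min_def zs_def)
  qed

  \<comment> \<open>Passage to the random sample\<close>
  have "finite G" using N(1) by (simp add: G_def)
  moreover have "F \<in> sets borel" using F(1) by simp
  ultimately have "\<forall>\<^sub>F n in sequentially. \<forall>(M :: 'w measure) X. prob_space M \<longrightarrow>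
      prob_space.indep_vars M (\<lambda>_. borel) X {..<n} \<longrightarrow> (\<forall>i<n. distr M borel (X i) = P) \<longrightarrow>
      (\<exists>E\<in>sets M. 1 - n powr - (p / 2) < measure M E \<and> (\<forall>\<omega>\<in>E. (\<forall>i<n. X i \<omega> \<in> F) \<and>
        (\<forall>g\<in>G. (\<Sum>i<n. g (X i \<omega>)) / n < P.expectation g + e')))"
    using G_meas G_bd e'(1) AE_F by (intro hoeffding_finite_class)
  then have "\<forall>\<^sub>F n in sequentially.
    \<forall>(M :: 'w measure) (X :: nat \<Rightarrow> 'w \<Rightarrow> 'a).
      prob_space M \<longrightarrow>
      prob_space.indep_vars M (\<lambda>_. borel) X {..<n} \<longrightarrow>
      (\<forall>i<n. distr M borel (X i) = P) \<longrightarrow>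
      (\<exists>E\<in>sets M. measure M E > 1 - real n powr (- p / 2) \<and>
        (\<forall>\<omega>\<in>E. \<forall>s::nat. real s / real (n + s) \<le> b \<longrightarrow>
          (\<forall>xs :: 'a list. length xs = s \<longrightarrow> set xs \<subseteq> \<Omega> \<longrightarrow>
            (\<forall>c. is_arg_min
                   (trimmed_distortion \<Omega> \<phi> (empirical_measure (map (\<lambda>i. X i \<omega>) [0..<n] @ xs)) h)
                   (\<lambda>c. c \<in> codebooks \<Omega> k) c \<longrightarrow>
               Max ((\<lambda>j. bregman_set \<Omega> \<phi> (cball 0 C) (c ! j)) ` {..<k}) \<le> ereal T))))"
    using eventually_gt_at_top[of "0::nat"]
  proof eventually_elim
    case (elim n)
    show ?case
    proof (intro allI impI)
      fix M :: "'w measure" and X :: "nat \<Rightarrow> 'w \<Rightarrow> 'a"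
      assume MX: "prob_space M" "prob_space.indep_vars M (\<lambda>_. borel) X {..<n}"
        "\<forall>i<n. distr M borel (X i) = P"
      \<comment> \<open>The event concerns the clean sample alone, so it serves all
        \<open>s\<close>, all adversarial points and all minimisers at once.\<close>
      obtain E where E: "E \<in> sets M" "1 - n powr - (p / 2) < measure M E"
        and E_conc: "\<forall>\<omega>\<in>E. (\<forall>i<n. X i \<omega> \<in> F) \<and>
          (\<forall>g\<in>G. (\<Sum>i<n. g (X i \<omega>)) / n < P.expectation g + e')"
        using elim(1)[THEN spec[of _ M], THEN spec[of _ X], THEN mp, OF MX(1), THEN mp, OF MX(2),
          THEN mp, OF MX(3)] by (elim bexE conjE)
      show "\<exists>E\<in>sets M. measure M E > 1 - real n powr (- p / 2) \<and>
        (\<forall>\<omega>\<in>E. \<forall>s::nat. real s / real (n + s) \<le> b \<longrightarrow>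
          (\<forall>xs :: 'a list. length xs = s \<longrightarrow> set xs \<subseteq> \<Omega> \<longrightarrow>
            (\<forall>c. is_arg_min
                   (trimmed_distortion \<Omega> \<phi> (empirical_measure (map (\<lambda>i. X i \<omega>) [0..<n] @ xs)) h)
                   (\<lambda>c. c \<in> codebooks \<Omega> k) c \<longrightarrow>
               Max ((\<lambda>j. bregman_set \<Omega> \<phi> (cball 0 C) (c ! j)) ` {..<k}) \<le> ereal T)))"
      proof (intro bexI[OF _ E(1)] conjI ballI allI impI)
        show "1 - real n powr (- p / 2) < measure M E" using E(2) by simp
        fix \<omega> s and xs :: "'a list" and c
        assume "\<omega> \<in> E" "real s / real (n + s) \<le> b" "length xs = s" "set xs \<subseteq> \<Omega>"
          "is_arg_min (trimmed_distortion \<Omega> \<phi> (empirical_measure (map (\<lambda>i. X i \<omega>) [0..<n] @ xs)) h)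
             (\<lambda>c. c \<in> codebooks \<Omega> k) c"
        then show "Max ((\<lambda>j. bregman_set \<Omega> \<phi> (cball 0 C) (c ! j)) ` {..<k}) \<le> ereal T"
          using E_conc elim(2) by (intro robust[of n "\<lambda>i. X i \<omega>" xs c]) auto
      qed
    qed
  qed
  then show ?thesis by blast
qed

end
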